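(* Let $\eta$ be a highest weight vector of $L(m,n)$, $m,n\in\mathbb N$. For any $a,b,c\in\mathbb N$ with $b\ge a+c$, $B_1^{(a)}B_2^{(b)}B_1^{(c)}\eta=0$ if and only if $F_1^{(a)}F_2^{(b)}F_1^{(c)}\eta=0$. Furthermore, the set $$\{B_1^{(a)}B_2^{(b)}B_1^{(c)}\eta\mid c\le m,\ a\le b-c\le n\}\cup\{B_2^{(c)}B_1^{(b)}B_2^{(a)}\eta\mid a\le n,\ c\le b-a\le m\}$$ ($a,b,c\in\mathbb N$) forms a basis of $L(m,n)$, modulo the identification $B_1^{(a)}B_2^{(b)}B_1^{(c)}\eta=B_2^{(c)}B_1^{(b)}B_2^{(a)}\eta$ for $b=a+c$.
   Context: $\mathbf U=\mathbf U_q(\mathfrak{sl}_3)$ over $\mathbb F$, the algebraic closure of $\mathbb Q(q)$, with Chevalley generators $E_a,F_a,K_a^{\pm1}$ ($a=1,2$), $[E_a,F_b]=\delta_{ab}\frac{K_a-K_a^{-1}}{q-q^{-1}}$. For $\varsigma_1,\varsigma_2\in\mathbb F^\times$ arbitrary, $\mathbf U^\imath(\mathfrak{sl}_3)\subset\mathbf U$ is the quasi-split iquantum group generated by $B_1=F_1+\varsigma_1E_2K_1^{-1}$, $B_2=F_2+\varsigma_2E_1K_2^{-1}$, $k_1=K_1K_2^{-1}$ and $k_1^{-1}$. $[r]=\frac{q^r-q^{-r}}{q-q^{-1}}$. Divided powers: $F_a^{(r)}=F_a^r/[r]!$, $B_a^{(r)}=B_a^r/[r]!$. $L(m,n)$ is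 the simple $\mathbf U$-module with highest weight $m\omega_1+n\omega_2$, $\omega_1,\omega_2$ the fundamental weights. *)

theory Defs
  imports
    "HOL-Algebra.Algebraic_Closure_Type"
    "HOL-Computational_Algebra.Fraction_Field"
    "HOL-Computational_Algebra.Polynomial"
    "HOL-Library.Poly_Mapping"
begin

section \<open>Ground field\<close>

text \<open>The algebraic closure of the field of rational functions \<open>\<rat>(q)\<close>.\<close>

type_synonym qfield = "rat poly fract alg_closure"

definition qq :: qfield where
  "qq = to_ac (Fract [:0, 1:] 1)"

definition qint :: "nat \<Rightarrow> qfield" where
  "qint r = (qq ^ r - inverse qq ^ r) / (qq - inverse qq)"

definition qfact :: "nat \<Rightarrow> qfield" where
  "qfact r = (\<Prod>i=1..r. qint i)"


section \<open>The quantum group of type \<open>A\<^sub>2\<close>\<close>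

subsection \<open>The free algebra on the Chevalley generators\<close>

datatype node = N1 | N2

datatype uq_gen = GE node | GF node | GK node | GKinv node

text \<open>Words under concatenation, written additively because
  \<^theory>\<open>HOL-Library.Poly_Mapping\<close> builds the monoid algebra of an additive monoid.\<close>

datatype 'a fmonoid = FWord (letters: "'a list")

instantiation fmonoid :: (type) monoid_add
begin

definition zero_fmonoid :: "'a fmonoid" where
  "0 = FWord []"

definition plus_fmonoid :: "'a fmonoid \<Rightarrow> 'a fmonoid \<Rightarrow> 'a fmonoid" where
  "u + v = FWord (letters u @ letters v)"

instance
  by standard (simp_all add: zero_fmonoid_def plus_fmonoid_def)

end

type_synonym uq_free = "uq_gen fmonoid \<Rightarrow>\<^sub>0 qfield"

abbreviation fgen :: "uq_gen \<Rightarrow> uq_free" where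
  "fgen g \<equiv> Poly_Mapping.single (FWord [g]) 1"

abbreviation fconst :: "qfield \<Rightarrow> uq_free" where
  "fconst c \<equiv> Poly_Mapping.single 0 c"


subsection \<open>Defining relations\<close>

fun cartan :: "node \<Rightarrow> node \<Rightarrow> int" where
  "cartan a b = (if a = b then 2 else -1)"

inductive uq_relation :: "uq_free \<Rightarrow> uq_free \<Rightarrow> bool" where
  K_Kinv: "uq_relation (fgen (GK a) * fgen (GKinv a)) 1"
| Kinv_K: "uq_relation (fgen (GKinv a) * fgen (GK a)) 1"
| K_K: "uq_relation (fgen (GK a) * fgen (GK b)) (fgen (GK b) * fgen (GK a))"
| K_E: "uq_relation (fgen (GK a) * fgen (GE b))
          (fconst (qq powi cartan a b) * fgen (GE b) * fgen (GK a))"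
| K_F: "uq_relation (fgen (GK a) * fgen (GF b))
          (fconst (qq powi (- cartan a b)) * fgen (GF b) * fgen (GK a))"
| E_F: "uq_relation (fgen (GE a) * fgen (GF b) - fgen (GF b) * fgen (GE a))
          (if a = b then fconst (1 / (qq - inverse qq)) * (fgen (GK a) - fgen (GKinv a)) else 0)"
| Serre_E: "a \<noteq> b \<Longrightarrow> uq_relation
     (fgen (GE a) ^ 2 * fgen (GE b) - fconst (qint 2) * fgen (GE a) * fgen (GE b) * fgen (GE a)
        + fgen (GE b) * fgen (GE a) ^ 2) 0"
| Serre_F: "a \<noteq> b \<Longrightarrow> uq_relation
     (fgen (GF a) ^ 2 * fgen (GF b) - fconst (qint 2) * fgen (GF a) * fgen (GF b) * fgen (GF a)
        + fgen (GF b) * fgen (GF a) ^ 2) 0"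

text \<open>Congruence modulo the two-sided ideal generated by the relations.\<close>

inductive uq_cong :: "uq_free \<Rightarrow> uq_free \<Rightarrow> bool" where
  base: "uq_relation x y \<Longrightarrow> uq_cong x y"
| refl: "uq_cong x x"
| sym: "uq_cong x y \<Longrightarrow> uq_cong y x"
| trans: "uq_cong x y \<Longrightarrow> uq_cong y z \<Longrightarrow> uq_cong x z"
| add: "uq_cong x x' \<Longrightarrow> uq_cong y y' \<Longrightarrow> uq_cong (x + y) (x' + y')"
| mult: "uq_cong x x' \<Longrightarrow> uq_cong y y' \<Longrightarrow> uq_cong (x * y) (x' * y')"

lemma uq_cong_uminus: "uq_cong x y \<Longrightarrow> uq_cong (- x) (- y)"
  using uq_cong.mult[OF uq_cong.refl[of "- 1"], of x y] by simp

text \<open>The counit of the free algebra respects the relations, so the quotient is not the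
  zero ring; this is needed for the class \<^class>\<open>ring_1\<close>.\<close>

fun gen_counit :: "uq_gen \<Rightarrow> qfield" where
  "gen_counit (GE a) = 0"
| "gen_counit (GF a) = 0"
| "gen_counit (GK a) = 1"
| "gen_counit (GKinv a) = 1"

definition word_counit :: "uq_gen fmonoid \<Rightarrow> qfield" where
  "word_counit w = prod_list (map gen_counit (letters w))"

definition free_counit :: "uq_free \<Rightarrow> qfield" where
  "free_counit x = (\<Sum>w\<in>Poly_Mapping.keys x. Poly_Mapping.lookup x w * word_counit w)"

lemma free_counit_superset:
  assumes "finite A" "Poly_Mapping.keys x \<subseteq> A"
  shows "free_counit x = (\<Sum>w\<in>A. Poly_Mapping.lookup x w * word_counit w)"
  unfolding free_counit_def
  by (rule sum.mono_neutral_left) (use assms in \<open>auto simp: in_keys_iff\<close>)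

lemma free_counit_add: "free_counit (x + y) = free_counit x + free_counit y"
proof -
  let ?A = "Poly_Mapping.keys x \<union> Poly_Mapping.keys y"
  have "Poly_Mapping.keys (x + y) \<subseteq> ?A"
    by (rule Poly_Mapping.keys_add)
  then show ?thesis
    by (simp add: free_counit_superset[of ?A] lookup_add distrib_right sum.distrib)
qed

lemma free_counit_single: "free_counit (Poly_Mapping.single w c) = c * word_counit w"
  by (simp add: free_counit_superset[of "{w}"])

lemma word_counit_add: "word_counit (u + v) = word_counit u * word_counit v"
  by (simp add: word_counit_def plus_fmonoid_def)

lemma uq_free_induct:
  assumes "P 0" and "\<And>x w c. P x \<Longrightarrow> P (x + Poly_Mapping.single w c)"
  shows "P (x :: uq_free)"
proof (induction x rule: Poly_Mapping.update_induct)
  case const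
  show ?case by (rule assms(1))
next
  case (update x w c)
  have "Poly_Mapping.update w c x = x + Poly_Mapping.single w c"
    using update by (intro poly_mapping_eqI)
      (auto simp: lookup_update lookup_add lookup_single in_keys_iff when_def)
  then show ?case using assms(2)[OF \<open>P x\<close>] by simp
qed

lemma free_counit_mult: "free_counit (x * y) = free_counit x * free_counit y"
proof -
  have single: "free_counit (Poly_Mapping.single w c * y)
      = free_counit (Poly_Mapping.single w c) * free_counit y" for w c
  proof (induction y rule: uq_free_induct)
    case 1
    show ?case by (simp add: free_counit_def)
  next
    case (2 x u d)
    then show ?case
      by (simp add: distrib_left free_counit_add mult_single free_counit_single word_counit_add
          algebra_simps)
  qed
  show ?thesis
  proof (induction x rule: uq_free_induct)
    case 1
    show ?case by (simp add: free_counit_def)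
  next
    case (2 x w c)
    then show ?case by (simp add: distrib_right free_counit_add single)
  qed
qed

lemma free_counit_0: "free_counit 0 = 0"
  by (simp add: free_counit_def)

lemma free_counit_const: "free_counit (fconst c) = c"
  by (simp add: free_counit_single word_counit_def zero_fmonoid_def)

lemma free_counit_1: "free_counit 1 = 1"
  using free_counit_const[of 1] by simp

lemma free_counit_uminus: "free_counit (- x) = - free_counit x"
  using free_counit_add[of x "- x"] by (simp add: free_counit_0 eq_neg_iff_add_eq_0 add.commute)

lemma free_counit_diff: "free_counit (x - y) = free_counit x - free_counit y"
  using free_counit_add[of x "- y"] by (simp add: free_counit_uminus)

lemma free_counit_gen: "free_counit (fgen g) = gen_counit g"
  by (simp add: free_counit_single word_counit_def)

lemma uq_cong_free_counit: "uq_cong x y \<Longrightarrow> free_counit x = free_counit y"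
proof (induction rule: uq_cong.induct)
  case (base x y)
  then show ?case
    by (induction rule: uq_relation.induct)
      (simp_all add: free_counit_add free_counit_mult free_counit_diff free_counit_gen
        free_counit_0 free_counit_1 power2_eq_square)
qed (simp_all add: free_counit_add free_counit_mult)


subsection \<open>The algebra \<open>U = U\<^sub>q(sl\<^sub>3)\<close>\<close>

quotient_type uq = uq_free / uq_cong
  by (rule equivpI) (auto intro: reflpI sympI transpI uq_cong.intros)

instantiation uq :: ring_1
begin

lift_definition zero_uq :: uq is 0 .
lift_definition one_uq :: uq is 1 .
lift_definition plus_uq :: "uq \<Rightarrow> uq \<Rightarrow> uq" is "(+)" by (rule uq_cong.add)
lift_definition times_uq :: "uq \<Rightarrow> uq \<Rightarrow> uq" is "(*)" by (rule uq_cong.mult)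
lift_definition uminus_uq :: "uq \<Rightarrow> uq" is uminus by (rule uq_cong_uminus)
lift_definition minus_uq :: "uq \<Rightarrow> uq \<Rightarrow> uq" is "(-)"
  using uq_cong.add uq_cong_uminus by fastforce

instance
proof
  fix x y z :: uq
  show "x + y + z = x + (y + z)" by transfer (simp add: add.assoc uq_cong.refl)
  show "x + y = y + x" by transfer (simp add: add.commute uq_cong.refl)
  show "0 + x = x" by transfer (simp add: uq_cong.refl)
  show "- x + x = 0" by transfer (simp add: uq_cong.refl)
  show "x - y = x + - y" by transfer (simp add: uq_cong.refl)
  show "x * y * z = x * (y * z)" by transfer (simp add: mult.assoc uq_cong.refl)
  show "1 * x = x" by transfer (simp add: uq_cong.refl)
  show "x * 1 = x" by transfer (simp add: uq_cong.refl)
  show "(x + y) * z = x * z + y * z" by transfer (simp add: distrib_right uq_cong.refl)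
  show "x * (y + z) = x * y + x * z" by transfer (simp add: distrib_left uq_cong.refl)
  show "(0::uq) \<noteq> 1"
  proof (transfer, rule notI)
    assume "uq_cong 0 1"
    from uq_cong_free_counit[OF this] show False
      by (simp add: free_counit_0 free_counit_1)
  qed
qed

end

lift_definition uconst :: "qfield \<Rightarrow> uq" is "\<lambda>c. fconst c" .
lift_definition uE :: "node \<Rightarrow> uq" is "\<lambda>a. fgen (GE a)" .
lift_definition uF :: "node \<Rightarrow> uq" is "\<lambda>a. fgen (GF a)" .
lift_definition uK :: "node \<Rightarrow> uq" is "\<lambda>a. fgen (GK a)" .
lift_definition uKinv :: "node \<Rightarrow> uq" is "\<lambda>a. fgen (GKinv a)" .

definition divpow :: "uq \<Rightarrow> nat \<Rightarrow> uq" where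
  "divpow x r = uconst (1 / qfact r) * x ^ r"


subsection \<open>Generators of the quasi-split iquantum group\<close>

text \<open>The parameters \<open>\<sigma>\<^sub>1, \<sigma>\<^sub>2\<close> are meant to be nonzero; the remaining generators of the
  iquantum group are \<open>K\<^sub>1 K\<^sub>2\<^sup>-\<^sup>1\<close> and its inverse.\<close>

definition B1 :: "qfield \<Rightarrow> uq" where
  "B1 \<sigma>\<^sub>1 = uF N1 + uconst \<sigma>\<^sub>1 * uE N2 * uKinv N1"

definition B2 :: "qfield \<Rightarrow> uq" where
  "B2 \<sigma>\<^sub>2 = uF N2 + uconst \<sigma>\<^sub>2 * uE N1 * uKinv N2"


section \<open>Modules\<close>

locale uq_module = vector_space scale
  for scale :: "qfield \<Rightarrow> 'v::ab_group_add \<Rightarrow> 'v" +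
  fixes act :: "uq \<Rightarrow> 'v \<Rightarrow> 'v"
  assumes act_one: "act 1 v = v"
    and act_mult: "act (x * y) v = act x (act y v)"
    and act_add_left: "act (x + y) v = act x v + act y v"
    and act_add_right: "act x (v + w) = act x v + act x w"
    and act_const: "act (uconst c) v = scale c v"
begin

definition uq_submodule :: "'v set \<Rightarrow> bool" where
  "uq_submodule W \<longleftrightarrow> subspace W \<and> (\<forall>x. \<forall>w\<in>W. act x w \<in> W)"

definition simple_module :: bool where
  "simple_module \<longleftrightarrow>
     (UNIV :: 'v set) \<noteq> {0} \<and> (\<forall>W. uq_submodule W \<longrightarrow> W = {0} \<or> W = UNIV)"

text \<open>Highest weight \<open>m\<omega>\<^sub>1 + n\<omega>\<^sub>2\<close>, so that \<open>K\<^sub>1\<close> and \<open>K\<^sub>2\<close> act by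
  \<open>q\<^sup>m\<close> and \<open>q\<^sup>n\<close>.\<close>

definition highest_weight_vector :: "nat \<Rightarrow> nat \<Rightarrow> 'v \<Rightarrow> bool" where
  "highest_weight_vector m n v \<longleftrightarrow> v \<noteq> 0 \<and> (\<forall>a. act (uE a) v = 0) \<and>
     act (uK N1) v = scale (qq ^ m) v \<and> act (uK N2) v = scale (qq ^ n) v"

definition is_basis :: "'v set \<Rightarrow> bool" where
  "is_basis A \<longleftrightarrow> independent A \<and> span A = UNIV"

end

text \<open>The carrier type with the given action is (a copy of) \<open>L(m,n)\<close>.\<close>

locale simple_uq_module_L = uq_module scale act
  for scale :: "qfield \<Rightarrow> 'v::ab_group_add \<Rightarrow> 'v" and act :: "uq \<Rightarrow> 'v \<Rightarrow> 'v" +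
  fixes m n :: nat
  assumes simple: "simple_module"
    and highest_weight: "\<exists>v. highest_weight_vector m n v"

end

theory Submission
  imports Defs
begin

text \<open>
  Since \<open>F\<^sub>2\<close> and \<open>E\<^sub>1K\<^sub>2\<^sup>-\<^sup>1\<close> \<open>q\<close>-commute, the divided powers of \<open>B\<^sub>2\<close> are given by the
  \<open>q\<close>-binomial theorem. On a highest weight vector, \<open>B\<^sub>1\<^sup>(\<^sup>a\<^sup>)B\<^sub>2\<^sup>(\<^sup>b\<^sup>)B\<^sub>1\<^sup>(\<^sup>c\<^sup>)\<eta>\<close> with \<open>a + c \<le> b\<close> therefore
  expands as a sum of multiples of \<open>F\<^sub>1\<^sup>(\<^sup>a\<^sup>-\<^sup>j\<^sup>)F\<^sub>2\<^sup>(\<^sup>b\<^sup>-\<^sup>i\<^sup>-\<^sup>j\<^sup>)F\<^sub>1\<^sup>(\<^sup>c\<^sup>-\<^sup>i\<^sup>)\<eta>\<close>, with leading coefficient \<open>1\<close>. The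
  coefficients are symmetric for \<open>b = a + c\<close>, which reduces the identification of the two
  families to the identity \<open>F\<^sub>1\<^sup>(\<^sup>a\<^sup>)F\<^sub>2\<^sup>(\<^sup>a\<^sup>+\<^sup>c\<^sup>)F\<^sub>1\<^sup>(\<^sup>c\<^sup>) = F\<^sub>2\<^sup>(\<^sup>c\<^sup>)F\<^sub>1\<^sup>(\<^sup>a\<^sup>+\<^sup>c\<^sup>)F\<^sub>2\<^sup>(\<^sup>a\<^sup>)\<close>, and unitriangularity reduces the
  basis statement to that for the monomials in \<open>F\<^sub>1, F\<^sub>2\<close>.
  These span because their span is a submodule. Their independence within a weight space is
  tested against \<open>E\<^sub>2\<^sup>r\<^sup>-\<^sup>kE\<^sub>1\<^sup>pE\<^sub>2\<^sup>k\<close>: up to nonzero factors attached to rows and columns, the resulting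
  matrix is the Hankel matrix with entries \<open>[n-r+s]![m+r-s]!\<close>, \<open>s = c + k\<close>, which is nonsingular.
\<close>

section \<open>Quantum integers\<close>

locale generic_q =
  fixes q :: "'k::field"
  assumes q_nonzero: "q \<noteq> 0"
    and q_not_root_of_unity: "k > 0 \<Longrightarrow> q ^ k \<noteq> 1"
begin

definition qi :: "int \<Rightarrow> 'k" where
  "qi x = (q powi x - q powi (- x)) / (q - inverse q)"

definition qf :: "nat \<Rightarrow> 'k" where
  "qf r = (\<Prod>i=1..r. qi (int i))"

lemma powi_eq_1_iff: "q powi x = 1 \<longleftrightarrow> x = 0"
proof
  assume *: "q powi x = 1"
  show "x = 0"
  proof (rule ccontr)
    assume "x \<noteq> 0"
    then have "q ^ nat \<bar>x\<bar> = 1"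
      using * by (cases "x \<ge> 0") (auto simp: power_int_def power_inverse)
    with \<open>x \<noteq> 0\<close> show False using q_not_root_of_unity[of "nat \<bar>x\<bar>"] by simp
  qed
qed simp

lemma powi_eq_iff: "q powi x = q powi y \<longleftrightarrow> x = y"
  using powi_eq_1_iff[of "x - y"] q_nonzero by (simp add: power_int_diff)

lemma q_diff_nonzero: "q - inverse q \<noteq> 0"
  using powi_eq_iff[of 1 "-1"] by simp

lemma qi_0 [simp]: "qi 0 = 0" and qi_1 [simp]: "qi 1 = 1"
  using q_diff_nonzero by (simp_all add: qi_def)

lemma qi_minus: "qi (- x) = - qi x"
  by (simp add: qi_def minus_divide_left)

lemma qi_eq_0_iff [simp]: "qi x = 0 \<longleftrightarrow> x = 0"
  using powi_eq_iff[of x "- x"] q_diff_nonzero by (auto simp: qi_def)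

lemma qf_0 [simp]: "qf 0 = 1" and qf_Suc: "qf (Suc r) = qi (int r + 1) * qf r"
  by (simp_all add: qf_def atLeastAtMostSuc_conv mult.commute add.commute)

lemma qf_nonzero [simp]: "qf r \<noteq> 0"
  by (auto simp: qf_def)

text \<open>Reduces every identity between sums of products of two quantum integers to linear
  arithmetic in the even function \<open>q\<^sup>x + q\<^sup>-\<^sup>x\<close>.\<close>

lemma qi_mult:
  "qi x * qi y = (q powi (x + y) + q powi (- x - y) - q powi (x - y) - q powi (y - x))
     / (q - inverse q)\<^sup>2"
proof -
  have "(q powi x - q powi (- x)) * (q powi y - q powi (- y)) =
      q powi (x + y) + q powi (- x - y) - q powi (x - y) - q powi (y - x)"
    using q_nonzero by (simp add: power_int_add power_int_diff power_int_minus field_simps)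
  then show ?thesis by (simp add: qi_def power2_eq_square)
qed

text \<open>The analogue of sin x sin (y+z) = sin (x+z) sin y + sin z sin (x-y). The coefficient
  identities in the inductions below are mostly instances of it.\<close>

lemma qi_exchange: "qi x * qi (y + z) = qi (x + z) * qi y + qi z * qi (x - y)"
  unfolding qi_mult add_divide_distrib[symmetric]
  by (rule arg_cong[where f="\<lambda>t. t / _"]) (simp add: algebra_simps)

lemma qi_exchange_minus: "qi x * qi (y - z) - qi y * qi (x + z) = - qi z * qi (x + y)"
  unfolding qi_mult minus_mult_left[symmetric] minus_divide_left diff_divide_distrib[symmetric]
  by (rule arg_cong[where f="\<lambda>t. t / _"]) (simp add: algebra_simps, rule arg_cong[where f="\<lambda>t. q powi t"], simp)

lemma qi_mult_plus_1: "qi (x + 1) * qi (y + 1) = qi x * qi y + qi (x + y + 1)"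
  using qi_exchange[of "x + 1" "- y" "- 1"] qi_minus[of 1] qi_minus[of "y + 1"]
  by (simp add: qi_minus algebra_simps)

lemma qi_shift: "qi x * q powi i = qi (x - i) + qi i * q powi x"
proof -
  have "(q powi x - q powi (- x)) * q powi i =
     (q powi (x - i) - q powi (- (x - i))) + (q powi i - q powi (- i)) * q powi x"
    using q_nonzero by (simp add: power_int_add power_int_diff power_int_minus field_simps)
  then show ?thesis
    unfolding qi_def times_divide_eq_left add_divide_distrib[symmetric] by simp
qed

text \<open>Nonsingularity of the Hankel matrix with entries \<open>[A+s]![B+2d-s]!\<close>, \<open>s = i + j\<close>:
  \<open>[A+j+1]\<close> times row \<open>j\<close> minus \<open>[B+2d-j]\<close> times row \<open>j+1\<close> kills the column \<open>i = 0\<close> and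
  leaves a matrix of the same shape.\<close>

lemma hankel_qf:
  fixes \<mu> :: "nat \<Rightarrow> 'k"
  assumes "\<And>j. j \<le> d \<Longrightarrow> (\<Sum>i\<le>d. \<mu> i * (qf (A + i + j) * qf (B + 2 * d - i - j))) = 0"
    and "i \<le> d"
  shows "\<mu> i = 0"
  using assms
proof (induction d arbitrary: A \<mu> i)
  case 0
  then show ?case by simp
next
  case (Suc d)
  let ?g = "\<lambda>i j. qf (A + i + j) * qf (B + 2 * Suc d - i - j)"
  have key: "qi (int (A + j + 1)) * ?g i j - qi (int (B + 2 * Suc d - j)) * ?g i (Suc j) =
      - qi (int i) * qi (int (A + B + 2 * d + 3)) * (qf (A + i + j) * qf (B + 2 * d + 1 - i - j))"
    if "i \<le> Suc d" "j \<le> d" for i j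
  proof -
    have 1: "qf (B + 2 * Suc d - i - j)
        = qi (int (B + 2 * Suc d - i - j)) * qf (B + 2 * d + 1 - i - j)"
      using that qf_Suc[of "B + 2 * d + 1 - i - j"]
      by (simp add: Suc_diff_le of_nat_diff algebra_simps)
    have 2: "qf (A + i + Suc j) = qi (int (A + i + j + 1)) * qf (A + i + j)"
      by (simp add: qf_Suc add_ac)
    have 3: "B + 2 * Suc d - i - Suc j = B + 2 * d + 1 - i - j"
      by simp
    have 4: "qi (int (A + j + 1)) * qi (int (B + 2 * Suc d - i - j))
       - qi (int (B + 2 * Suc d - j)) * qi (int (A + i + j + 1))
       = - qi (int i) * qi (int (A + B + 2 * d + 3))"
      using qi_exchange_minus[of "int (A + j + 1)" "int (B + 2 * Suc d - j)" "int i"] that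
      by (simp add: of_nat_diff algebra_simps)
    show ?thesis
      unfolding 1 2 3 using arg_cong[OF 4, of "\<lambda>t. t * (qf (A + i + j) * qf (B + 2 * d + 1 - i - j))"]
      by (simp only: left_diff_distrib right_diff_distrib mult_ac)
  qed
  \<comment> \<open>The factor \<open>qi (int i)\<close> removes the column \<open>i = 0\<close>.
    After shifting \<open>i\<close>, the sum has the shape of the induction hypothesis with
    \<open>A\<close> raised by one and unknowns
    \<open>\<mu> (Suc i) * qi (int (Suc i))\<close>.\<close>
  have "(\<Sum>i\<le>d. (\<mu> (Suc i) * qi (int (Suc i))) * (qf (Suc A + i + j) * qf (B + 2 * d - i - j))) = 0"
    if "j \<le> d" for j
  proof -
    have "0 = (\<Sum>i\<le>Suc d. \<mu> i * (qi (int (A + j + 1)) * ?g i j - qi (int (B + 2 * Suc d - j)) * ?g i (Suc j)))"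
      using arg_cong[OF Suc.prems(1)[of j], of "\<lambda>t. qi (int (A + j + 1)) * t"]
       arg_cong[OF Suc.prems(1)[of "Suc j"], of "\<lambda>t. qi (int (B + 2 * Suc d - j)) * t"] that
      unfolding sum_distrib_left right_diff_distrib sum_subtractf by (simp add: mult.left_commute)
    also have "\<dots> = (\<Sum>i\<le>Suc d. \<mu> i * (- qi (int i) * qi (int (A + B + 2 * d + 3)) * (qf (A + i + j) * qf (B + 2 * d + 1 - i - j))))"
      by (intro sum.cong HOL.refl arg_cong2[where f="(*)"] key) (use that in auto)
    also have "\<dots> = - qi (int (A + B + 2 * d + 3)) *
       (\<Sum>i\<le>d. (\<mu> (Suc i) * qi (int (Suc i))) * (qf (Suc A + i + j) * qf (B + 2 * d - i - j)))"
      unfolding sum.atMost_Suc_shift sum_distrib_left by (simp add: mult_ac)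
    finally show ?thesis by simp
  qed
  from Suc.IH[OF this] have *: "\<mu> (Suc i) = 0" if "i \<le> d" for i
    using that by fastforce
  have "\<mu> 0 * ?g 0 0 = 0"
    using Suc.prems(1)[of 0] * unfolding sum.atMost_Suc_shift by simp
  with * Suc.prems(2) show ?case by (cases i) auto
qed

end

section \<open>Consequences of the quantum Serre relations\<close>

locale generic_q_vector_space = generic_q q + vector_space scale
  for q :: "'k::field" and scale :: "'k \<Rightarrow> 'v::ab_group_add \<Rightarrow> 'v" (infixr "*s" 75)
begin

abbreviation endo :: "('v \<Rightarrow> 'v) \<Rightarrow> bool" where
  "endo T \<equiv> module_hom scale scale T"

lemmas endo_simps = module_hom.add module_hom.scale module_hom.zero module_hom.sum
  module_hom.diff module_hom.neg

definition dp :: "('v \<Rightarrow> 'v) \<Rightarrow> nat \<Rightarrow> 'v \<Rightarrow> 'v" where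
  "dp T r v = (1 / qf r) *s (T ^^ r) v"

lemma endoI: "(\<And>v w. T (v + w) = T v + T w) \<Longrightarrow> (\<And>c v. T (c *s v) = c *s T v) \<Longrightarrow> endo T"
  by unfold_locales

lemma endo_funpow: "endo T \<Longrightarrow> endo (T ^^ r)"
  by (induction r) (auto intro!: endoI simp: endo_simps)

lemma endo_dp: "endo T \<Longrightarrow> endo (dp T r)"
  by (auto intro!: endoI simp: dp_def endo_simps[OF endo_funpow] scale_right_distrib mult.commute)

lemma dp_0 [simp]: "dp T 0 v = v" and dp_1 [simp]: "dp T (Suc 0) v = T v"
  by (simp_all add: dp_def qf_Suc)

lemma dp_step: "endo T \<Longrightarrow> T (dp T r v) = qi (int (Suc r)) *s dp T (Suc r) v"
  by (simp add: dp_def endo_simps qf_Suc add.commute)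

lemma dp_step_right: "endo T \<Longrightarrow> dp T r (T v) = qi (int (Suc r)) *s dp T (Suc r) v"
  by (simp add: dp_def endo_simps qf_Suc add.commute funpow_swap1)

lemma dp_commute: "endo S \<Longrightarrow> (\<And>v. T (S v) = S (T v)) \<Longrightarrow> dp T r (S v) = S (dp T r v)"
proof -
  assume S: "endo S" and com: "\<And>v. T (S v) = S (T v)"
  have "(T ^^ r) (S v) = S ((T ^^ r) v)"
    by (induction r) (simp_all add: com)
  then show ?thesis by (simp add: dp_def endo_simps[OF S])
qed

text \<open>Multiplication by \<open>[r+1]\<close> turns a divided power into a single application
  of the operator, so the inductions on divided powers prove this multiple of their claim and cancel
  at the end.\<close>

lemma qi_Suc_cancel: "qi (int (Suc r)) *s v = qi (int (Suc r)) *s w \<Longrightarrow> v = w"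
  by (simp del: of_nat_Suc)

end

locale serre_pair = generic_q_vector_space q scale
  for q :: "'k::field" and scale :: "'k \<Rightarrow> 'v::ab_group_add \<Rightarrow> 'v" (infixr "*s" 75) +
  fixes F G :: "'v \<Rightarrow> 'v"
  assumes endo_F: "endo F" and endo_G: "endo G"
    and serre_FG: "F (F (G v)) + G (F (F v)) = qi 2 *s F (G (F v))"
    and serre_GF: "G (G (F v)) + F (G (G v)) = qi 2 *s G (F (G v))"
begin

lemma serre_pair_flip: "serre_pair q scale G F"
  by (intro serre_pair.intro serre_pair_axioms.intro generic_q_vector_space_axioms
      endo_F endo_G serre_FG serre_GF)

lemmas endos [simp] = endo_simps[OF endo_F] endo_simps[OF endo_G]
  endo_simps[OF endo_dp[OF endo_F]] endo_simps[OF endo_dp[OF endo_G]]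

text \<open>For \<open>k \<ge> 2\<close> multiplying each side by \<open>[k]\<close> expresses it through the other one; the resulting
  linear system has determinant \<open>[k]\<^sup>2 - 1 = [k-1][k+1]\<close>.\<close>

lemma serre_dp_aux:
  "dp G k (F (G v)) = qi (int k) *s dp G (Suc k) (F v) + F (dp G (Suc k) v) \<and>
   G (F (dp G k v)) = qi (int k) *s F (dp G (Suc k) v) + dp G (Suc k) (F v)"
proof (induction k arbitrary: v)
  case 0
  then show ?case by simp
next
  case (Suc k)
  define a b c where "a = qi (int k)" and "b = qi (int (Suc k))" and "c = qi (int (Suc (Suc k)))"
  \<comment> \<open>\<open>U\<close> and \<open>Y\<close> are the left-hand sides for
    \<open>Suc k\<close>. The induction hypothesis, taken at \<open>v\<close> and at
    \<open>G v\<close>, gives the linear system for them.\<close>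
  define U Y P R where "U = dp G (Suc k) (F (G v))" and "Y = G (F (dp G (Suc k) v))"
    and "P = F (dp G (Suc (Suc k)) v)" and "R = dp G (Suc (Suc k)) (F v)"
  have abc: "a * c + 1 = b * b"
    using qi_exchange[of "int (Suc k)" "int k" 1] by (simp add: a_def b_def c_def add_ac)
  have U: "b *s U = (a * c) *s R + Y"
  proof -
    have "b *s U = G (dp G k (F (G v)))"
      by (simp only: b_def U_def dp_step[OF endo_G])
    also have "\<dots> = (a * c) *s R + Y"
      unfolding conjunct1[OF Suc[of v]]
      by (simp add: a_def c_def R_def Y_def dp_step[OF endo_G] del: of_nat_Suc)
    finally show ?thesis .
  qed
  have Y: "b *s Y = (a * c) *s P + U"
  proof -
    have "b *s Y = G (F (dp G k (G v)))"
      by (simp add: b_def Y_def dp_step_right[OF endo_G] del: of_nat_Suc)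
    also have "\<dots> = (a * c) *s P + U"
      unfolding conjunct2[OF Suc[of "G v"]]
      by (simp add: a_def c_def P_def U_def dp_step_right[OF endo_G] del: of_nat_Suc)
    finally show ?thesis .
  qed
  have "U = b *s R + P \<and> Y = b *s P + R"
  proof (cases "k = 0")
    case True
    \<comment> \<open>Here \<open>a = qi 0\<close> vanishes and the system is degenerate; the
      quantum Serre relation supplies the missing equation.\<close>
    have "c *s U = c *s (b *s R + P)"
      using serre_GF[of v] True dp_step[OF endo_G, of "Suc 0" "F v"] dp_step[OF endo_G, of "Suc 0" v]
      by (simp add: U_def P_def R_def b_def c_def scale_right_distrib
          flip: endo_simps(2)[OF endo_F])
    then have "U = b *s R + P"
      by (simp add: c_def del: of_nat_Suc)
    moreover from True have "U = Y" "b = 1"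
      by (simp_all add: U_def Y_def b_def)
    ultimately show ?thesis by (simp add: add.commute)
  next
    case False
    have ac: "a * c \<noteq> 0" using False by (simp add: a_def c_def del: of_nat_Suc)
    have bb: "(b * b) *s v = (a * c) *s v + v" for v
      using abc scale_left_distrib[of "a * c" 1 v] by simp
    have "(a * c) *s U + U = b *s (b *s U)"
      by (simp add: bb)
    also have "\<dots> = (a * c) *s (b *s R + P) + U"
      by (simp add: U Y scale_right_distrib mult_ac)
    finally have 1: "U = b *s R + P" using ac by (simp del: scale_scale)
    have "(a * c) *s Y + Y = b *s (b *s Y)"
      by (simp add: bb)
    also have "\<dots> = (a * c) *s (b *s P + R) + Y"
      by (simp add: U Y scale_right_distrib mult_ac)
    finally have "Y = b *s P + R" using ac by (simp del: scale_scale)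
    with 1 show ?thesis by simp
  qed
  then show ?case by (simp add: U_def Y_def P_def R_def b_def)
qed

lemma dp_GFG: "dp G k (F (G v)) = qi (int k) *s dp G (Suc k) (F v) + F (dp G (Suc k) v)"
  and GF_dp_G: "G (F (dp G k v)) = qi (int k) *s F (dp G (Suc k) v) + dp G (Suc k) (F v)"
  using serre_dp_aux by blast+

lemma qi_coeff: "qi (int b - int c) * qi (int (Suc (Suc b))) + qi (int (Suc c)) =
    qi (int (Suc b)) * qi (int (Suc b) - int c)"
  using qi_exchange[of "int (Suc b)" "int b - int c" 1] by (simp add: algebra_simps)

text \<open>The case \<open>b = 0\<close> is \<open>dp_GFG\<close> rearranged. The step peels one
  \<open>F\<close> off the right end of \<open>dp F (Suc b)\<close> and reorders the resulting
  \<open>G F\<close> with \<open>dp_GFG\<close> for the exchanged pair.\<close>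

lemma F_dp_G_dp_F:
  "F (dp G (Suc c) (dp F b v)) =
     qi (int b - int c) *s dp G (Suc c) (dp F (Suc b) v) + dp G c (dp F (Suc b) (G v))"
proof (induction b arbitrary: v)
  case 0
  then show ?case by (simp add: dp_GFG qi_minus)
next
  case (Suc b)
  interpret flip: serre_pair q scale G F by (rule serre_pair_flip)
  have "qi (int (Suc b)) *s F (dp G (Suc c) (dp F (Suc b) v)) = F (dp G (Suc c) (dp F b (F v)))"
    by (simp add: dp_step_right[OF endo_F] del: of_nat_Suc)
  also have "\<dots> = (qi (int b - int c) * qi (int (Suc (Suc b))) + qi (int (Suc c))) *s
      dp G (Suc c) (dp F (Suc (Suc b)) v) + qi (int (Suc b)) *s dp G c (dp F (Suc (Suc b)) (G v))"
    unfolding Suc by (simp add: dp_step_right[OF endo_F] dp_step_right[OF endo_G] flip.dp_GFG scale_left_distrib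
        del: of_nat_Suc)
  also have "\<dots> = qi (int (Suc b)) *s (qi (int (Suc b) - int c) *s dp G (Suc c) (dp F (Suc (Suc b)) v)
      + dp G c (dp F (Suc (Suc b)) (G v)))"
    by (simp only: qi_coeff scale_right_distrib scale_scale)
  finally show ?case by (rule qi_Suc_cancel)
qed

text \<open>The argument for \<open>F_dp_G_dp_F\<close> with all products reversed: it starts from
  \<open>GF_dp_G\<close> and peels \<open>F\<close> off on the left.\<close>

lemma dp_F_dp_G_F:
  "dp F b (dp G (Suc c) (F v)) =
     qi (int b - int c) *s dp F (Suc b) (dp G (Suc c) v) + G (dp F (Suc b) (dp G c v))"
proof (induction b arbitrary: v)
  case 0
  then show ?case by (simp add: GF_dp_G qi_minus)
next
  case (Suc b)
  interpret flip: serre_pair q scale G F by (rule serre_pair_flip)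
  have "qi (int (Suc b)) *s dp F (Suc b) (dp G (Suc c) (F v)) = F (dp F b (dp G (Suc c) (F v)))"
    by (simp add: dp_step[OF endo_F] del: of_nat_Suc)
  also have "\<dots> = (qi (int b - int c) * qi (int (Suc (Suc b))) + qi (int (Suc c))) *s
      dp F (Suc (Suc b)) (dp G (Suc c) v) + qi (int (Suc b)) *s G (dp F (Suc (Suc b)) (dp G c v))"
    unfolding Suc by (simp add: dp_step[OF endo_F] dp_step[OF endo_G] flip.GF_dp_G scale_left_distrib
        del: of_nat_Suc)
  also have "\<dots> = qi (int (Suc b)) *s (qi (int (Suc b) - int c) *s dp F (Suc (Suc b)) (dp G (Suc c) v)
      + G (dp F (Suc (Suc b)) (dp G c v)))"
    by (simp only: qi_coeff scale_right_distrib scale_scale)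
  finally show ?case by (rule qi_Suc_cancel)
qed

text \<open>The step peels an \<open>F\<close> off the leftmost power and moves it inwards.
  Multiplying the remainder \<open>?Y\<close> by \<open>[c+1]\<close> makes it a monomial at
  \<open>F (G v)\<close>, where the induction hypothesis applies a second time. The two terms in
  \<open>?Q a (Suc c)\<close> then cancel, which leaves \<open>[a+1][c+1]\<close> times the
  claim.\<close>

lemma dp_braid: "dp F a (dp G (a + c) (dp F c v)) = dp G c (dp F (a + c) (dp G a v))"
proof (induction a arbitrary: c v)
  case 0
  then show ?case by simp
next
  case (Suc a)
  let ?P = "\<lambda>a c. dp F a (dp G (a + c) (dp F c v))" and ?Q = "\<lambda>a c. dp G c (dp F (a + c) (dp G a v))"
  let ?A = "qi (int (Suc a))" and ?C = "qi (int (Suc c))" and ?a = "qi (int a)" and ?c = "qi (int c)"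
  let ?Y = "dp F a (dp G (a + c) (dp F (Suc c) (G v)))"
  let ?Z = "dp G c (dp F (a + c) (dp G (Suc a) (F v)))"
  have 1: "?A *s ?P (Suc a) c = - (?a *s ?Q a (Suc c)) + ?Y"
  proof -
    have "?A *s ?P (Suc a) c = dp F a (F (dp G (Suc (a + c)) (dp F c v)))"
      by (simp add: dp_step_right[OF endo_F] del: of_nat_Suc)
    also have "\<dots> = - (?a *s ?P a (Suc c)) + ?Y"
      by (simp add: F_dp_G_dp_F qi_minus)
    finally show ?thesis by (simp only: Suc)
  qed
  have 2: "?C *s ?Y = ?a *s ?Z + qi (int (Suc (a + c))) *s ?Q (Suc a) c"
  proof -
    have "?C *s ?Y = dp F a (dp G (a + c) (dp F c (F (G v))))"
      by (simp add: dp_step_right[OF endo_F] del: of_nat_Suc)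
    also have "\<dots> = dp G c (dp F (a + c) (dp G a (F (G v))))"
      by (rule Suc)
    also have "\<dots> = ?a *s ?Z + qi (int (Suc (a + c))) *s ?Q (Suc a) c"
      by (simp add: dp_GFG dp_step_right[OF endo_F] del: of_nat_Suc)
    finally show ?thesis .
  qed
  have 3: "?Z = ?c *s ?Q (Suc a) c + ?C *s ?Q a (Suc c)"
    by (simp add: dp_F_dp_G_F dp_step_right[OF endo_G] del: of_nat_Suc)
  have 4: "?a * ?c + qi (int (Suc (a + c))) = ?C * ?A"
    using qi_mult_plus_1[of "int c" "int a"] by (simp add: ac_simps)
  have "?C *s (?A *s ?P (Suc a) c) = (?a * ?c + qi (int (Suc (a + c)))) *s ?Q (Suc a) c"
    unfolding 1 scale_right_distrib 2 3 scale_left_distrib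
    by (simp add: mult_ac del: of_nat_Suc)
  then have "?C *s (?A *s ?P (Suc a) c) = ?C *s (?A *s ?Q (Suc a) c)"
    unfolding 4 by (simp only: scale_scale)
  then show ?case by (blast dest: qi_Suc_cancel)
qed

end

section \<open>Highest weight vectors in modules over the quantum group\<close>

text \<open>\<open>J1\<close> and \<open>J2\<close> are the inverses of \<open>K1\<close> and \<open>K2\<close>. All statements are transported along the
  diagram automorphism by the lemmas named \<open>flip\<close>.\<close>

locale sl3_module = generic_q_vector_space q scale
  for q :: "'k::field" and scale :: "'k \<Rightarrow> 'v::ab_group_add \<Rightarrow> 'v" (infixr "*s" 75) +
  fixes E1 E2 F1 F2 K1 K2 J1 J2 :: "'v \<Rightarrow> 'v"
  assumes endo_E1: "endo E1" and endo_E2: "endo E2" and endo_F1: "endo F1" and endo_F2: "endo F2"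
    and endo_K1: "endo K1" and endo_K2: "endo K2" and endo_J1: "endo J1" and endo_J2: "endo J2"
    and J1_K1: "J1 (K1 v) = v" and J2_K2: "J2 (K2 v) = v"
    and K1_E1: "K1 (E1 v) = q powi 2 *s E1 (K1 v)" and K2_E2: "K2 (E2 v) = q powi 2 *s E2 (K2 v)"
    and K1_E2: "K1 (E2 v) = q powi - 1 *s E2 (K1 v)" and K2_E1: "K2 (E1 v) = q powi - 1 *s E1 (K2 v)"
    and K1_F1: "K1 (F1 v) = q powi - 2 *s F1 (K1 v)" and K2_F2: "K2 (F2 v) = q powi - 2 *s F2 (K2 v)"
    and K1_F2: "K1 (F2 v) = q powi 1 *s F2 (K1 v)" and K2_F1: "K2 (F1 v) = q powi 1 *s F1 (K2 v)"
    and E1_F1: "E1 (F1 v) - F1 (E1 v) = (1 / (q - inverse q)) *s (K1 v - J1 v)"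
    and E2_F2: "E2 (F2 v) - F2 (E2 v) = (1 / (q - inverse q)) *s (K2 v - J2 v)"
    and E1_F2: "E1 (F2 v) = F2 (E1 v)" and E2_F1: "E2 (F1 v) = F1 (E2 v)"
    and serre_12: "F1 (F1 (F2 v)) + F2 (F1 (F1 v)) = qi 2 *s F1 (F2 (F1 v))"
    and serre_21: "F2 (F2 (F1 v)) + F1 (F2 (F2 v)) = qi 2 *s F2 (F1 (F2 v))"
begin

lemma sl3_module_flip: "sl3_module q scale E2 E1 F2 F1 K2 K1 J2 J1"
  by (intro sl3_module.intro sl3_module_axioms.intro generic_q_vector_space_axioms
      endo_E1 endo_E2 endo_F1 endo_F2 endo_K1 endo_K2 endo_J1 endo_J2 J1_K1 J2_K2
      K1_E1 K1_E2 K2_E1 K2_E2 K1_F1 K1_F2 K2_F1 K2_F2 E1_F1 E1_F2 E2_F1 E2_F2 serre_12 serre_21)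

sublocale serre_pair q scale F1 F2
  by (intro serre_pair.intro serre_pair_axioms.intro generic_q_vector_space_axioms
      endo_F1 endo_F2 serre_12 serre_21)

lemmas endos' [simp] = endo_simps[OF endo_E1] endo_simps[OF endo_E2]
  endo_simps[OF endo_K1] endo_simps[OF endo_K2] endo_simps[OF endo_J1] endo_simps[OF endo_J2]

section \<open>Weight vectors and commutation relations with divided powers\<close>

abbreviation "f1 \<equiv> dp F1"
abbreviation "f2 \<equiv> dp F2"

text \<open>Zero has every weight, so vectors need not be known to be nonzero before weights are
  assigned to them.\<close>

definition wt :: "int \<Rightarrow> int \<Rightarrow> 'v \<Rightarrow> bool" where
  "wt x y v \<longleftrightarrow> K1 v = q powi x *s v \<and> K2 v = q powi y *s v"

lemma wt_flip: "sl3_module.wt q scale K2 K1 x y v \<longleftrightarrow> wt y x v"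
  using sl3_module.wt_def[OF sl3_module_flip] by (auto simp: wt_def)

lemma wt_scale: "wt x y v \<Longrightarrow> wt x y (c *s v)"
  by (simp add: wt_def mult.commute)

lemma wt_sum: "(\<And>i. i \<in> A \<Longrightarrow> wt x y (v i)) \<Longrightarrow> wt x y (sum v A)"
  by (simp add: wt_def scale_sum_right)

lemma wt_F1: "wt x y v \<Longrightarrow> wt (x - 2) (y + 1) (F1 v)"
  and wt_E1: "wt x y v \<Longrightarrow> wt (x + 2) (y - 1) (E1 v)"
  using q_nonzero by (simp_all add: wt_def K1_F1 K2_F1 K1_E1 K2_E1
      power_int_add power_int_diff power_int_minus field_simps)

lemma wt_f1: "wt x y v \<Longrightarrow> wt (x - 2 * int a) (y + int a) (f1 a v)"
proof -
  assume v: "wt x y v"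
  have "wt (x - 2 * int a) (y + int a) ((F1 ^^ a) v)"
    by (induction a) (use v in \<open>auto dest: wt_F1 simp: algebra_simps\<close>)
  then show ?thesis by (simp add: dp_def wt_scale)
qed

lemma wt_e1: "wt x y v \<Longrightarrow> wt (x + 2 * int a) (y - int a) (dp E1 a v)"
proof -
  assume v: "wt x y v"
  have "wt (x + 2 * int a) (y - int a) ((E1 ^^ a) v)"
    by (induction a) (use v in \<open>auto dest: wt_E1 simp: algebra_simps\<close>)
  then show ?thesis by (simp add: dp_def wt_scale)
qed

lemma wt_f2: "wt x y v \<Longrightarrow> wt (x + int a) (y - 2 * int a) (f2 a v)"
  using sl3_module.wt_f1[OF sl3_module_flip, unfolded wt_flip] .

lemma J1_wt: "wt x y v \<Longrightarrow> J1 v = q powi - x *s v"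
proof -
  assume "wt x y v"
  then have "q powi x *s J1 v = v"
    using J1_K1[of v] by (simp add: wt_def)
  then have "q powi - x *s (q powi x *s J1 v) = q powi - x *s v" by simp
  then show ?thesis using q_nonzero by (simp flip: power_int_add)
qed

lemma E1_F1_wt: "wt x y v \<Longrightarrow> E1 (F1 v) = F1 (E1 v) + qi x *s v"
proof -
  assume v: "wt x y v"
  have "E1 (F1 v) - F1 (E1 v) = qi x *s v"
    using v by (simp add: E1_F1 J1_wt[OF v] wt_def qi_def flip: scale_left_diff_distrib)
  then show ?thesis by (simp add: diff_eq_eq add.commute)
qed

lemma E1_f2: "E1 (f2 b v) = f2 b (E1 v)"
  using dp_commute[OF endo_E1, of F2] E1_F2 by simp

lemma E2_f1: "E2 (f1 b v) = f1 b (E2 v)"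
  using dp_commute[OF endo_E2, of F1] E2_F1 by simp

text \<open>The induction peels \<open>F1\<close> off on the right, so the hypothesis is used at
  \<open>F1 v\<close>, whose first weight coordinate is \<open>x - 2\<close>.\<close>

lemma E1_f1: "wt x y v \<Longrightarrow> E1 (f1 (Suc a) v) = f1 (Suc a) (E1 v) + qi (x - int a) *s f1 a v"
proof (induction a arbitrary: x y v)
  case 0
  then show ?case by (simp add: E1_F1_wt)
next
  case (Suc a)
  have "qi (int (Suc (Suc a))) *s E1 (f1 (Suc (Suc a)) v) = E1 (f1 (Suc a) (F1 v))"
    by (simp add: dp_step_right[OF endo_F1] del: of_nat_Suc)
  also have "\<dots> = qi (int (Suc (Suc a))) *s f1 (Suc (Suc a)) (E1 v)
      + (qi x + qi (x - 2 - int a) * qi (int (Suc a))) *s f1 (Suc a) v"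
    unfolding Suc.IH[OF wt_F1[OF Suc.prems]] E1_F1_wt[OF Suc.prems]
    by (simp add: dp_step_right[OF endo_F1] scale_left_distrib del: of_nat_Suc)
  also have "qi x + qi (x - 2 - int a) * qi (int (Suc a)) = qi (int (Suc (Suc a))) * qi (x - int (Suc a))"
    using qi_mult_plus_1[of "1 + int a" "x - 2 - int a"] by (simp add: algebra_simps)
  finally have "qi (int (Suc (Suc a))) *s E1 (f1 (Suc (Suc a)) v) = qi (int (Suc (Suc a))) *s
      (f1 (Suc (Suc a)) (E1 v) + qi (x - int (Suc a)) *s f1 (Suc a) v)"
    by (simp only: scale_right_distrib scale_scale)
  then show ?case by (rule qi_Suc_cancel)
qed

lemma E2_f2: "wt x y v \<Longrightarrow> E2 (f2 (Suc a) v) = f2 (Suc a) (E2 v) + qi (y - int a) *s f2 a v"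
  using sl3_module.E1_f1[OF sl3_module_flip, unfolded wt_flip] .

lemma dp_eq_0_mono: "endo T \<Longrightarrow> dp T r v = 0 \<Longrightarrow> r \<le> s \<Longrightarrow> dp T s v = 0"
proof (induction s)
  case (Suc s)
  show ?case
  proof (cases "r = Suc s")
    case False
    with Suc have "dp T s v = 0" by simp
    then show ?thesis
      using dp_step[OF Suc.prems(1), of s v] Suc.prems(1)
      by (simp add: endo_simps del: of_nat_Suc)
  qed (use Suc in simp)
qed simp

definition singular :: "int \<Rightarrow> int \<Rightarrow> 'v \<Rightarrow> bool" where
  "singular x y v \<longleftrightarrow> wt x y v \<and> E1 v = 0 \<and> E2 v = 0"

lemma singular_flip: "sl3_module.singular q scale E2 E1 K2 K1 x y v \<longleftrightarrow> singular y x v"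
  using sl3_module.singular_def[OF sl3_module_flip] by (auto simp: singular_def wt_flip)

lemma E1_f1_f2_f1:
  assumes "singular x y v"
  shows "E1 (f1 a (f2 b (f1 c v))) =
     (if a = 0 then 0 else qi (x - 2 * int c + int b - int a + 1) *s f1 (a - 1) (f2 b (f1 c v))) +
     (if c = 0 then 0 else qi (x - int c + 1) *s f1 a (f2 b (f1 (c - 1) v)))"
proof -
  have v: "wt x y v" "E1 v = 0" using assms by (auto simp: singular_def)
  have 1: "E1 (f2 b (f1 c v)) = (if c = 0 then 0 else qi (x - int c + 1) *s f2 b (f1 (c - 1) v))"
    by (cases c) (simp_all add: E1_f2 v E1_f1[OF v(1)])
  show ?thesis
    using 1 by (cases a) (simp_all add: E1_f1[OF wt_f2[OF wt_f1[OF v(1)]]] algebra_simps)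
qed

lemma E2_f1_f2_f1:
  assumes "singular x y v"
  shows "E2 (f1 a (f2 b (f1 c v))) =
     (if b = 0 then 0 else qi (y + int c - int b + 1) *s f1 a (f2 (b - 1) (f1 c v)))"
proof -
  have v: "wt x y v" "E2 v = 0" using assms by (auto simp: singular_def)
  show ?thesis
    by (cases b) (simp_all add: E2_f1 v E2_f2[OF wt_f1[OF v(1)]] algebra_simps)
qed

section \<open>The span of the monomials is a submodule\<close>

definition monomials :: "'v \<Rightarrow> 'v set" where
  "monomials v = {f1 a (f2 b (f1 c v)) | a b c. a + c \<le> b} \<union> {f2 a (f1 b (f2 c v)) | a b c. a + c \<le> b}"

text \<open>Being a submodule, expressed through the operators of the generators because no algebra
  acts in this locale.\<close>

definition invariant :: "'v set \<Rightarrow> bool" where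
  "invariant W \<longleftrightarrow> subspace W \<and>
     (\<forall>w\<in>W. E1 w \<in> W \<and> E2 w \<in> W \<and> F1 w \<in> W \<and> F2 w \<in> W \<and> K1 w \<in> W \<and> K2 w \<in> W \<and> J1 w \<in> W \<and> J2 w \<in> W)"

lemma monomials_flip: "sl3_module.monomials q scale F2 F1 v = monomials v"
  using sl3_module.monomials_def[OF sl3_module_flip] by (auto simp: monomials_def)

lemma invariant_flip: "sl3_module.invariant scale E2 E1 F2 F1 K2 K1 J2 J1 W \<longleftrightarrow> invariant W"
  using sl3_module.invariant_def[OF sl3_module_flip] by (auto simp: invariant_def)

lemma monomials_wt:
  assumes "wt x y v" "u \<in> monomials v"
  obtains i j where "i \<ge> 0" "j \<ge> 0" "wt (x - 2 * i + j) (y - 2 * j + i) u"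
proof -
  consider a b c where "u = f1 a (f2 b (f1 c v))" | a b c where "u = f2 a (f1 b (f2 c v))"
    using assms(2) by (auto simp: monomials_def)
  then show ?thesis
  proof cases
    case (1 a b c)
    then show ?thesis
      using wt_f1[OF wt_f2[OF wt_f1[OF assms(1)]], of c b a]
      by (intro that[of "int (a + c)" "int b"]) (simp_all add: algebra_simps)
  next
    case (2 a b c)
    then show ?thesis
      using wt_f2[OF wt_f1[OF wt_f2[OF assms(1)]], of c b a]
      by (intro that[of "int b" "int (a + c)"]) (simp_all add: algebra_simps)
  qed
qed

text \<open>\<open>E1\<close> lowers \<open>a\<close> or \<open>c\<close> and preserves
  \<open>a + c \<le> b\<close>. \<open>E2\<close> lowers \<open>b\<close> and \<open>F1\<close>
  raises \<open>a\<close>, which stays inside the first family only if the inequality is strict. On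
  the second family, \<open>F1\<close> is moved inwards by \<open>F_dp_G_dp_F\<close>.\<close>

lemma monomials_closed_aux:
  assumes "singular x y v" "a + c \<le> b"
  shows "E1 (f1 a (f2 b (f1 c v))) \<in> span (monomials v)" "F1 (f2 a (f1 b (f2 c v))) \<in> span (monomials v)"
    "a + c < b \<Longrightarrow> E2 (f1 a (f2 b (f1 c v))) \<in> span (monomials v)"
    "a + c < b \<Longrightarrow> F1 (f1 a (f2 b (f1 c v))) \<in> span (monomials v)"
proof -
  have P: "f1 a (f2 b (f1 c v)) \<in> span (monomials v)" "f2 a (f1 b (f2 c v)) \<in> span (monomials v)"
    if "a + c \<le> b" for a b c
    by (rule span_base; use that in \<open>fastforce simp: monomials_def\<close>)+
  show "E1 (f1 a (f2 b (f1 c v))) \<in> span (monomials v)"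
    unfolding E1_f1_f2_f1[OF assms(1)]
    using assms(2) by (intro span_add) (auto simp del: dp_0 intro!: span_scale span_zero P)
  show "E2 (f1 a (f2 b (f1 c v))) \<in> span (monomials v)" if "a + c < b"
    unfolding E2_f1_f2_f1[OF assms(1)] using that by (auto intro!: span_scale P)
  show "F1 (f1 a (f2 b (f1 c v))) \<in> span (monomials v)" if "a + c < b"
    unfolding dp_step[OF endo_F1] using that by (auto intro!: span_scale P)
  show "F1 (f2 a (f1 b (f2 c v))) \<in> span (monomials v)"
  proof (cases a)
    case 0
    then show ?thesis
      using assms(2) P[of 0 c "Suc b"] by (simp add: dp_step[OF endo_F1] span_scale del: of_nat_Suc)
  next
    case (Suc a')
    then show ?thesis
      using assms(2) by (auto simp: F_dp_G_dp_F dp_step[OF endo_F2] simp del: of_nat_Suc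
          intro!: span_add span_scale P)
  qed
qed

text \<open>For \<open>a + c < b\<close> the auxiliary lemma and its flip cover all four operators.
  For \<open>b = a + c\<close> each covers only two of them, and \<open>dp_braid\<close> makes both
  available by writing \<open>u\<close> in either family.\<close>

lemma monomials_closed:
  assumes "singular x y v" "u \<in> monomials v"
  shows "E1 u \<in> span (monomials v)" "E2 u \<in> span (monomials v)" "F1 u \<in> span (monomials v)" "F2 u \<in> span (monomials v)"
proof -
  note aux = monomials_closed_aux[OF assms(1)]
  have s: "sl3_module.singular q scale E2 E1 K2 K1 y x v" using assms by (simp add: singular_flip)
  note aux' = sl3_module.monomials_closed_aux[OF sl3_module_flip s, unfolded monomials_flip]
  have "E1 u \<in> span (monomials v) \<and> E2 u \<in> span (monomials v) \<and> F1 u \<in> span (monomials v) \<and> F2 u \<in> span (monomials v)"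
  proof -
    consider a b c where "u = f1 a (f2 b (f1 c v))" "a + c < b"
      | a b c where "u = f2 a (f1 b (f2 c v))" "a + c < b"
      | a c where "u = f1 a (f2 (a + c) (f1 c v))" "u = f2 c (f1 (a + c) (f2 a v))"
    proof -
      from assms(2) consider a b c where "u = f1 a (f2 b (f1 c v))" "a + c \<le> b"
        | a b c where "u = f2 a (f1 b (f2 c v))" "a + c \<le> b"
        by (auto simp: monomials_def)
      then show ?thesis
      proof cases
        case (1 a b c)
        then show ?thesis using that(1)[of a b c] that(3)[of a c] dp_braid[of a c v]
          by (cases "a + c = b") auto
      next
        case (2 a b c)
        then show ?thesis using that(2)[of a b c] that(3)[of c a] dp_braid[of c a v]
          by (cases "a + c = b") (auto simp: add.commute)
      qed
    qed
    then show ?thesis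
    proof cases
      case (1 a b c)
      then show ?thesis using aux[of a c b] aux'[of a c b] by simp
    next
      case (2 a b c)
      then show ?thesis using aux[of a c b] aux'[of a c b] by simp
    next
      case (3 a c)
      have "E1 u \<in> span (monomials v)" "F2 u \<in> span (monomials v)"
        using aux(1)[of a c "a + c"] aux'(2)[of a c "a + c"] 3(1) by simp_all
      moreover have "E2 u \<in> span (monomials v)" "F1 u \<in> span (monomials v)"
        using aux'(1)[of c a "a + c"] aux(2)[of c a "a + c"] 3(2) by simp_all
      ultimately show ?thesis by simp
    qed
  qed
  then show "E1 u \<in> span (monomials v)" "E2 u \<in> span (monomials v)" "F1 u \<in> span (monomials v)" "F2 u \<in> span (monomials v)"
    by auto
qed

lemma endo_span_closed:
  assumes "endo T" "\<And>u. u \<in> A \<Longrightarrow> T u \<in> span A" "w \<in> span A"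
  shows "T w \<in> span A"
  using assms(3)
proof (induction rule: span_induct_alt)
  case base
  then show ?case by (simp add: endo_simps[OF assms(1)] span_zero)
next
  case (step c x y)
  then show ?case by (simp add: endo_simps[OF assms(1)] assms(2) span_add span_scale)
qed

lemma J2_wt: "wt x y v \<Longrightarrow> J2 v = q powi - y *s v"
  using sl3_module.J1_wt[OF sl3_module_flip, unfolded wt_flip] .

lemma invariant_span_monomials: "singular x y v \<Longrightarrow> invariant (span (monomials v))"
proof -
  assume v: "singular x y v"
  have "K1 u \<in> span (monomials v)" "K2 u \<in> span (monomials v)" "J1 u \<in> span (monomials v)" "J2 u \<in> span (monomials v)"
    if "u \<in> monomials v" for u
  proof -
    from v have "wt x y v" by (simp add: singular_def)
    then obtain i j where u: "wt (x - 2 * i + j) (y - 2 * j + i) u"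
      using \<open>u \<in> monomials v\<close> by (rule monomials_wt)
    show "K1 u \<in> span (monomials v)" "K2 u \<in> span (monomials v)" "J1 u \<in> span (monomials v)" "J2 u \<in> span (monomials v)"
      using u J1_wt[OF u] J2_wt[OF u] span_base[OF that] by (auto simp: wt_def span_scale)
  qed
  note closed = monomials_closed[OF v] this
  show ?thesis
    unfolding invariant_def
    by (intro conjI ballI subspace_span
        endo_span_closed[OF endo_E1 closed(1)] endo_span_closed[OF endo_E2 closed(2)]
        endo_span_closed[OF endo_F1 closed(3)] endo_span_closed[OF endo_F2 closed(4)]
        endo_span_closed[OF endo_K1 closed(5)] endo_span_closed[OF endo_K2 closed(6)]
        endo_span_closed[OF endo_J1 closed(7)] endo_span_closed[OF endo_J2 closed(8)])
qed

text \<open>A form of the independence of weight spaces in which the weights of the summands need not be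
  distinct from each other.\<close>

lemma wt_sum_eq_0:
  assumes "finite A" "\<And>i. i \<in> A \<Longrightarrow> wt (x i) (y i) (u i) \<and> (x i, y i) \<noteq> (x0, y0)"
    and "wt x0 y0 v" "v = sum u A"
  shows "v = 0"
  using assms
proof (induction A arbitrary: u v rule: finite_induct)
  case empty
  then show ?case by simp
next
  case (insert i A)
  \<comment> \<open>\<open>T\<close> is \<open>K1\<close> or \<open>K2\<close>, whichever separates
    the weight of \<open>u i\<close> from the target weight. Subtracting the eigenvalue at
    \<open>i\<close> removes this summand and only rescales the others and \<open>v\<close>.\<close>
  have "\<exists>T g. endo T \<and> T v = g (x0, y0) *s v \<and> g (x0, y0) \<noteq> g (x i, y i) \<and>
     (\<forall>j\<in>insert i A. T (u j) = g (x j, y j) *s u j)"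
  proof (cases "x i = x0")
    case True
    then have "q powi y0 \<noteq> q powi y i"
      using insert.prems(1)[of i] by (auto simp: powi_eq_iff)
    moreover have "K2 v = q powi y0 *s v" "\<forall>j\<in>insert i A. K2 (u j) = q powi y j *s u j"
      using insert.prems(1,2) by (auto simp: wt_def)
    ultimately show ?thesis
      using endo_K2 by (intro exI[of _ K2] exI[of _ "\<lambda>p. q powi snd p"]) simp
  next
    case False
    then have "q powi x0 \<noteq> q powi x i"
      using insert.prems(1)[of i] by (auto simp: powi_eq_iff)
    moreover have "K1 v = q powi x0 *s v" "\<forall>j\<in>insert i A. K1 (u j) = q powi x j *s u j"
      using insert.prems(1,2) by (auto simp: wt_def)
    ultimately show ?thesis
      using endo_K1 by (intro exI[of _ K1] exI[of _ "\<lambda>p. q powi fst p"]) simp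
  qed
  then obtain T g where T: "endo T" "T v = g (x0, y0) *s v" "g (x0, y0) \<noteq> g (x i, y i)"
    "\<And>j. j \<in> insert i A \<Longrightarrow> T (u j) = g (x j, y j) *s u j"
    by blast
  let ?a = "g (x i, y i)"
  have "(g (x0, y0) - ?a) *s v = T v - ?a *s v"
    by (simp add: T(2) scale_left_diff_distrib)
  also have "\<dots> = (\<Sum>j\<in>insert i A. T (u j) - ?a *s u j)"
    unfolding insert.prems(3) by (simp only: endo_simps[OF T(1)] scale_sum_right sum_subtractf)
  also have "\<dots> = (\<Sum>j\<in>insert i A. (g (x j, y j) - ?a) *s u j)"
    by (intro sum.cong HOL.refl) (simp add: T(4) scale_left_diff_distrib)
  also have "\<dots> = (\<Sum>j\<in>A. (g (x j, y j) - ?a) *s u j)"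
    using insert.hyps by simp
  finally have eq: "(g (x0, y0) - ?a) *s v = (\<Sum>j\<in>A. (g (x j, y j) - ?a) *s u j)" .
  have "(g (x0, y0) - ?a) *s v = 0"
    by (rule insert.IH[OF _ wt_scale[OF insert.prems(2)] eq]) (use insert.prems(1) wt_scale in auto)
  with T(3) show ?case by simp
qed

end

section \<open>Simple modules and the vanishing of monomials\<close>

locale simple_sl3_module = sl3_module q scale E1 E2 F1 F2 K1 K2 J1 J2
  for q :: "'k::field" and scale :: "'k \<Rightarrow> 'v::ab_group_add \<Rightarrow> 'v" (infixr "*s" 75)
    and E1 E2 F1 F2 K1 K2 J1 J2 :: "'v \<Rightarrow> 'v" +
  fixes m n :: nat and \<eta> :: 'v
  assumes irreducible: "invariant W \<Longrightarrow> W = {0} \<or> W = UNIV"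
    and singular_\<eta>: "singular (int m) (int n) \<eta>" and \<eta>_nonzero: "\<eta> \<noteq> 0"
begin

lemma simple_sl3_module_flip: "simple_sl3_module q scale E2 E1 F2 F1 K2 K1 J2 J1 n m \<eta>"
  by (rule simple_sl3_module.intro[OF sl3_module_flip], rule simple_sl3_module_axioms.intro)
    (unfold singular_flip invariant_flip, rule irreducible, assumption, fact singular_\<eta>, fact \<eta>_nonzero)

lemma wt_\<eta>: "wt (int m) (int n) \<eta>" and E1_\<eta> [simp]: "E1 \<eta> = 0" and E2_\<eta> [simp]: "E2 \<eta> = 0"
  using singular_\<eta> by (auto simp: singular_def)

lemma span_monomials_nonzero_singular: "singular x y v \<Longrightarrow> v \<noteq> 0 \<Longrightarrow> span (monomials v) = UNIV"
proof -
  assume v: "singular x y v" "v \<noteq> 0"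
  have "v \<in> monomials v" unfolding monomials_def
    by (rule UnI1, rule CollectI, rule exI[of _ 0], rule exI[of _ 0], rule exI[of _ 0]) simp
  then have "v \<in> span (monomials v)" by (rule span_base)
  with v(2) have "span (monomials v) \<noteq> {0}" by auto
  with irreducible[OF invariant_span_monomials[OF v(1)]] show ?thesis by simp
qed

text \<open>The weight lies \<open>i\<close> and \<open>j\<close> simple roots below the highest
  one. If \<open>v\<close> were nonzero, its monomials would span the module by irreducibility; all
  of them have weights different from that of \<eta>, so \<eta> would be zero.\<close>

lemma singular_eq_0:
  assumes "singular (int m - 2 * i + j) (int n - 2 * j + i) v" "i \<ge> 0" "j \<ge> 0" "i \<noteq> 0 \<or> j \<noteq> 0"
  shows "v = 0"
proof (rule ccontr)
  assume "v \<noteq> 0"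
  then have "\<eta> \<in> span (monomials v)"
    using span_monomials_nonzero_singular[OF assms(1)] by simp
  then obtain A r where A: "finite A" "A \<subseteq> monomials v" "\<eta> = (\<Sum>u\<in>A. r u *s u)"
    unfolding span_explicit by blast
  have "\<exists>x y. wt x y u \<and> (x, y) \<noteq> (int m, int n)" if "u \<in> A" for u
  proof -
    from that A(2) assms(1) obtain k l where "k \<ge> 0" "l \<ge> 0"
      "wt ((int m - 2 * i + j) - 2 * k + l) ((int n - 2 * j + i) - 2 * l + k) u"
      using monomials_wt unfolding singular_def by blast
    then show ?thesis using assms(2-4)
      by (intro exI[of _ "(int m - 2 * i + j) - 2 * k + l"] exI[of _ "(int n - 2 * j + i) - 2 * l + k"]) auto
  qed
  then have "\<forall>u\<in>A. \<exists>p. wt (fst p) (snd p) u \<and> p \<noteq> (int m, int n)"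
    by (metis fst_conv snd_conv)
  then obtain p where p: "\<forall>u\<in>A. wt (fst (p u)) (snd (p u)) u \<and> p u \<noteq> (int m, int n)"
    by (rule bchoice[THEN exE])
  have "\<eta> = 0"
    using A(3) p wt_scale by (intro wt_sum_eq_0[OF A(1) _ wt_\<eta>, of "\<lambda>u. fst (p u)" "\<lambda>u. snd (p u)" "\<lambda>u. r u *s u"]) auto
  with \<eta>_nonzero show False by simp
qed

text \<open>For exponent \<open>m + 1\<close> the vector is singular, as the coefficient in
  \<open>E1_f1\<close> is \<open>qi 0\<close>.\<close>

lemma f1_\<eta>_eq_0: "c > m \<Longrightarrow> f1 c \<eta> = 0"
proof -
  assume "c > m"
  have "f1 (Suc m) \<eta> = 0"
    by (rule singular_eq_0[of "int (Suc m)" 0])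
      (use wt_f1[OF wt_\<eta>, of "Suc m"] in \<open>auto simp: singular_def E2_f1 E1_f1[OF wt_\<eta>]\<close>)
  then show ?thesis using \<open>c > m\<close> dp_eq_0_mono[OF endo_F1] by simp
qed

text \<open>For \<open>b = n + c + 1\<close> the vector is singular: \<open>E2\<close> produces the
  coefficient \<open>qi 0\<close>, and \<open>E1\<close> lowers \<open>c\<close>, where the
  induction hypothesis applies.\<close>

lemma f2_f1_\<eta>_eq_0: "b > n + c \<Longrightarrow> f2 b (f1 c \<eta>) = 0"
proof (induction c arbitrary: b)
  case 0
  then show ?case
    using simple_sl3_module.f1_\<eta>_eq_0[OF simple_sl3_module_flip] by simp
next
  case (Suc c)
  let ?v = "f2 (Suc (n + Suc c)) (f1 (Suc c) \<eta>)"
  have "wt (int m - 2 * int (Suc c) + int (Suc (n + Suc c))) (int n + int (Suc c) - 2 * int (Suc (n + Suc c))) ?v"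
    using wt_f2[OF wt_f1[OF wt_\<eta>]] .
  moreover have "E2 ?v = 0"
    by (simp add: E2_f2[OF wt_f1[OF wt_\<eta>]] E2_f1)
  moreover have "E1 ?v = 0"
    using Suc.IH[of "Suc (n + Suc c)"] by (simp add: E1_f2 E1_f1[OF wt_\<eta>])
  ultimately have "?v = 0"
    by (intro singular_eq_0[of "int (Suc c)" "int (Suc (n + Suc c))"]) (auto simp: singular_def algebra_simps)
  then show ?case using Suc.prems dp_eq_0_mono[OF endo_F2] by simp
qed

lemma f1_f2_f1_\<eta>_eq_0: "m < c \<or> n + c < b \<Longrightarrow> f1 a (f2 b (f1 c \<eta>)) = 0"
  by (auto simp: f1_\<eta>_eq_0 f2_f1_\<eta>_eq_0)

end

section \<open>Expansion of the monomials in the generators of the iquantum group\<close>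

context generic_q_vector_space
begin

definition iB :: "'k \<Rightarrow> ('v \<Rightarrow> 'v) \<Rightarrow> ('v \<Rightarrow> 'v) \<Rightarrow> ('v \<Rightarrow> 'v) \<Rightarrow> 'v \<Rightarrow> 'v" where
  "iB s F E J v = F v + s *s E (J v)"

lemma endo_iB: "endo F \<Longrightarrow> endo E \<Longrightarrow> endo J \<Longrightarrow> endo (iB s F E J)"
  by (intro endoI) (simp_all add: iB_def endo_simps scale_right_distrib mult.commute)

text \<open>The \<open>q\<close>-binomial coefficient of \<open>z + i\<close> over \<open>i\<close>, where \<open>z\<close> may be negative.\<close>

definition qbin :: "int \<Rightarrow> nat \<Rightarrow> 'k" where
  "qbin z i = (\<Prod>s=1..i. qi (z + int s)) / qf i"

lemma qbin_0 [simp]: "qbin z 0 = 1"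
  by (simp add: qbin_def)

lemma qbin_Suc: "qi (int (Suc i)) * qbin z (Suc i) = qbin z i * qi (z + int (Suc i))"
  by (simp add: qbin_def qf_Suc add.commute del: of_nat_Suc) (simp add: add_ac)

text \<open>With \<open>X = E\<^sub>1K\<^sub>2\<^sup>-\<^sup>1\<close>, the \<open>q\<close>-binomial theorem contributes \<open>i (b - i)\<close>, reordering
  \<open>X\<^sup>i\<close> into \<open>E\<^sub>1\<^sup>iK\<^sub>2\<^sup>-\<^sup>i\<close> contributes \<open>i (i - 1) / 2\<close>, and \<open>K\<^sub>2\<^sup>-\<^sup>i\<close> contributes \<open>- i h\<close>.\<close>

definition bexp :: "nat \<Rightarrow> nat \<Rightarrow> int \<Rightarrow> int" where
  "bexp b i h = int i * (int b - int i) + int (\<Sum>{..<i}) - int i * h"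

lemma bexp_0 [simp]: "bexp b 0 h = 0"
  by (simp add: bexp_def)

text \<open>The Pascal rule behind \<open>dp_iB2\<close>: the first summand comes from applying
  \<open>F2\<close> to term \<open>Suc j\<close>, the second from applying \<open>E1\<close> after
  \<open>J2\<close> to term \<open>j\<close>.\<close>

lemma bexp_recursion:
  "qi (int (Suc b)) * q powi bexp (Suc b) (Suc j) h =
     qi (int b - int j) * q powi bexp b (Suc j) h
       + qi (int (Suc j)) * (q powi bexp b j h * q powi - (h - 2 * int b + int j))"
proof -
  define D where "D = bexp b (Suc j) h"
  have e: "bexp (Suc b) (Suc j) h = int (Suc j) + D"
    "bexp b j h + - (h - 2 * int b + int j) = int (Suc b) + D"
    by (simp_all add: bexp_def D_def algebra_simps)
  have "(qi (int (Suc b)) * q powi int (Suc j)) * q powi D =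
    (qi (int b - int j) + qi (int (Suc j)) * q powi int (Suc b)) * q powi D"
    by (subst qi_shift) simp
  then show ?thesis
    unfolding power_int_add[OF disjI1[OF q_nonzero], symmetric] e D_def[symmetric]
    unfolding power_int_add[OF disjI1[OF q_nonzero]] by (simp only: ring_distribs mult.assoc)
qed

end

context sl3_module
begin

abbreviation "iB1 s \<equiv> iB s F1 E2 J1"
abbreviation "iB2 s \<equiv> iB s F2 E1 J2"

lemma endo_iB1: "endo (iB1 s)" and endo_iB2: "endo (iB2 s)"
  by (simp_all add: endo_iB endo_F1 endo_F2 endo_E1 endo_E2 endo_J1 endo_J2)

lemma dp_iB2:
  assumes "wt x h v"
  shows "dp (iB2 s) b v = (\<Sum>i\<le>b. (s ^ i * q powi bexp b i h) *s f2 (b - i) (dp E1 i v))"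
proof (induction b)
  case 0
  then show ?case by simp
next
  case (Suc b)
  let ?u = "\<lambda>i. f2 (Suc b - i) (dp E1 i v)"
  \<comment> \<open>\<open>?X i\<close> and \<open>?Y i\<close> collect what \<open>F2\<close> and
    \<open>E1 J2\<close> contribute to \<open>?u i\<close>. Since \<open>?X (Suc b)\<close> contains
    \<open>qi 0\<close> and \<open>?Y 0\<close> is zero, both sums can run up to
    \<open>Suc b\<close>.\<close>
  let ?X = "\<lambda>i. (s ^ i * (qi (int (Suc b) - int i) * q powi bexp b i h)) *s ?u i"
  let ?Y = "\<lambda>i. if i = 0 then 0 else
    (s ^ i * (qi (int i) * (q powi bexp b (i - 1) h * q powi - (h - 2 * int b + int (i - 1))))) *s ?u i"
  have step: "iB2 s (f2 (b - i) (dp E1 i v)) = qi (int (Suc b) - int i) *s ?u i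
      + (s * (qi (int (Suc i)) * q powi - (h - 2 * int b + int i))) *s ?u (Suc i)" if "i \<le> b" for i
  proof -
    have "wt (x + 2 * int i + int (b - i)) (h - int i - 2 * int (b - i)) (f2 (b - i) (dp E1 i v))"
      using wt_f2[OF wt_e1[OF assms]] .
    also have "h - int i - 2 * int (b - i) = h - 2 * int b + int i"
      using that by (simp add: of_nat_diff)
    finally have "J2 (f2 (b - i) (dp E1 i v)) = q powi - (h - 2 * int b + int i) *s f2 (b - i) (dp E1 i v)"
      by (rule J2_wt)
    moreover have "int (Suc (b - i)) = int (Suc b) - int i" "Suc (b - i) = Suc b - i"
      using that by auto
    ultimately show ?thesis
      by (simp add: iB_def dp_step[OF endo_F2] E1_f2 dp_step[OF endo_E1] mult_ac del: of_nat_Suc)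
  qed
  have "qi (int (Suc b)) *s dp (iB2 s) (Suc b) v = iB2 s (dp (iB2 s) b v)"
    by (simp only: dp_step[OF endo_iB2])
  also have "\<dots> = (\<Sum>i\<le>b. (s ^ i * q powi bexp b i h) *s iB2 s (f2 (b - i) (dp E1 i v)))"
    unfolding Suc by (simp add: endo_simps[OF endo_iB2])
  also have "\<dots> = (\<Sum>i\<le>b. ?X i + ?Y (Suc i))"
    by (intro sum.cong HOL.refl) (simp add: step scale_right_distrib mult_ac del: of_nat_Suc)
  also have "\<dots> = (\<Sum>i\<le>Suc b. ?X i) + (\<Sum>i\<le>Suc b. ?Y i)"
    unfolding sum.distrib sum.atMost_Suc[of ?X] sum.atMost_Suc_shift[of ?Y] by simp
  also have "\<dots> = (\<Sum>i\<le>Suc b. ?X i + ?Y i)"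
    by (rule sum.distrib[symmetric])
  also have "\<dots> = (\<Sum>i\<le>Suc b. qi (int (Suc b)) *s ((s ^ i * q powi bexp (Suc b) i h) *s ?u i))"
  proof (intro sum.cong HOL.refl)
    fix i
    show "?X i + ?Y i = qi (int (Suc b)) *s ((s ^ i * q powi bexp (Suc b) i h) *s ?u i)"
    proof (cases i)
      case (Suc j)
      have "?X i + ?Y i = (s ^ Suc j * (qi (int (Suc b)) * q powi bexp (Suc b) (Suc j) h)) *s ?u (Suc j)"
        unfolding bexp_recursion Suc distrib_left scale_left_distrib by simp
      then show ?thesis by (simp add: Suc mult_ac del: of_nat_Suc)
    qed simp
  qed
  finally show ?case
    unfolding scale_sum_right[symmetric] by (rule qi_Suc_cancel)
qed

lemma e1_f1:
  assumes "wt h y v" "E1 v = 0"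
  shows "dp E1 i (f1 c v) = (if i \<le> c then qbin (h - int c) i *s f1 (c - i) v else 0)"
proof (induction i)
  case 0
  then show ?case by simp
next
  case (Suc i)
  have "qi (int (Suc i)) *s dp E1 (Suc i) (f1 c v) = E1 (dp E1 i (f1 c v))"
    by (simp only: dp_step[OF endo_E1])
  also have "\<dots> = (if Suc i \<le> c then (qbin (h - int c) i * qi (h - int c + int (Suc i))) *s f1 (c - Suc i) v else 0)"
  proof (cases "Suc i \<le> c")
    case True
    then obtain d where d: "c = Suc i + d" using le_Suc_ex by blast
    then have "dp E1 i (f1 c v) = qbin (h - int c) i *s f1 (Suc d) v"
      using Suc by (simp add: Suc_diff_le)
    then show ?thesis by (simp add: d Suc_diff_le E1_f1[OF assms(1)] assms(2) algebra_simps)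
  qed (auto simp: Suc not_less_eq_eq assms)
  finally show ?case
    by (cases "Suc i \<le> c") (simp_all flip: qbin_Suc scale_scale del: of_nat_Suc)
qed

end

context simple_sl3_module
begin

text \<open>\<open>E2\<close> commutes with \<open>F1\<close> and kills \<eta>, so only the summand
  \<open>F1\<close> of the operator contributes.\<close>

lemma dp_iB1_\<eta>: "dp (iB1 s) c \<eta> = f1 c \<eta>"
proof (induction c)
  case (Suc c)
  have "qi (int (Suc c)) *s dp (iB1 s) (Suc c) \<eta> = iB1 s (f1 c \<eta>)"
    by (simp only: dp_step[OF endo_iB1] Suc[symmetric])
  also have "\<dots> = qi (int (Suc c)) *s f1 (Suc c) \<eta>"
    by (simp add: iB_def J1_wt[OF wt_f1[OF wt_\<eta>]] E2_f1 dp_step[OF endo_F1] del: of_nat_Suc)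
  finally show ?case by (rule qi_Suc_cancel)
qed simp

text \<open>\<open>i\<close> counts the factors \<open>E1\<close> taken from the power of
  \<open>iB2\<close>, and \<open>j\<close> the factors \<open>E2\<close> taken from the left power
  of \<open>iB1\<close>. The last arguments of \<open>bexp\<close> are the weights of the vectors to
  which these powers are applied.\<close>

definition bcoeff :: "'k \<Rightarrow> 'k \<Rightarrow> nat \<Rightarrow> nat \<Rightarrow> nat \<Rightarrow> nat \<Rightarrow> nat \<Rightarrow> 'k" where
  "bcoeff s1 s2 a b c i j =
     s2 ^ i * q powi bexp b i (int n + int c) * qbin (int m - int c) i *
     (s1 ^ j * q powi bexp a j (int m - 2 * int c + int b + int i) * qbin (int n + int c - int b) j)"

lemma bcoeff_0 [simp]: "bcoeff s1 s2 a b c 0 0 = 1"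
  by (simp add: bcoeff_def)

lemma dp_iB_expansion:
  assumes "a + c \<le> b"
  shows "dp (iB1 s1) a (dp (iB2 s2) b (dp (iB1 s1) c \<eta>)) =
     (\<Sum>i\<le>c. \<Sum>j\<le>a. bcoeff s1 s2 a b c i j *s f1 (a - j) (f2 (b - i - j) (f1 (c - i) \<eta>)))"
proof -
  interpret flip: sl3_module q scale E2 E1 F2 F1 K2 K1 J2 J1 by (rule sl3_module_flip)
  have "dp (iB2 s2) b (f1 c \<eta>) =
     (\<Sum>i\<le>b. (s2 ^ i * q powi bexp b i (int n + int c)) *s f2 (b - i) (dp E1 i (f1 c \<eta>)))"
    by (rule dp_iB2[OF wt_f1[OF wt_\<eta>]])
  also have "\<dots> = (\<Sum>i\<le>c. (s2 ^ i * q powi bexp b i (int n + int c)) *s f2 (b - i) (dp E1 i (f1 c \<eta>)))"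
    by (rule sum.mono_neutral_right) (use assms in \<open>auto simp: e1_f1[OF wt_\<eta>]\<close>)
  also have "\<dots> = (\<Sum>i\<le>c. (s2 ^ i * q powi bexp b i (int n + int c) * qbin (int m - int c) i) *s
      f2 (b - i) (f1 (c - i) \<eta>))"
    by (intro sum.cong HOL.refl) (simp add: e1_f1[OF wt_\<eta>])
  finally have 1: "dp (iB2 s2) b (f1 c \<eta>) = \<dots>" .
  have 2: "dp (iB1 s1) a (f2 (b - i) (f1 (c - i) \<eta>)) =
      (\<Sum>j\<le>a. (s1 ^ j * q powi bexp a j (int m - 2 * int c + int b + int i) * qbin (int n + int c - int b) j) *s
        f1 (a - j) (f2 (b - i - j) (f1 (c - i) \<eta>)))" if "i \<le> c" for i
  proof -
    have wt1: "wt (int m - 2 * int (c - i)) (int n + int (c - i)) (f1 (c - i) \<eta>)"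
      using wt_f1[OF wt_\<eta>] .
    have w: "int m - 2 * int (c - i) + int (b - i) = int m - 2 * int c + int b + int i"
      "int n + int (c - i) - int (b - i) = int n + int c - int b"
      using that assms by (auto simp: of_nat_diff)
    have "dp E2 j (f2 (b - i) (f1 (c - i) \<eta>)) = qbin (int n + int c - int b) j *s f2 (b - i - j) (f1 (c - i) \<eta>)"
      if "j \<le> a" for j
    proof -
      have "E2 (f1 (c - i) \<eta>) = 0" by (simp add: E2_f1)
      \<comment> \<open>This is where \<open>a + c \<le> b\<close> enters: enough factors
        \<open>F2\<close> remain to avoid the zero branch of \<open>e1_f1\<close>.\<close>
      moreover have "j \<le> b - i" using that \<open>i \<le> c\<close> assms by linarith
      ultimately show ?thesis
        using flip.e1_f1[unfolded wt_flip, OF wt1, of j "b - i"] \<open>j \<le> b - i\<close> unfolding w(2) by simp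
    qed
    then show ?thesis
      unfolding flip.dp_iB2[unfolded wt_flip, OF wt_f2[OF wt1]] w(1)
      by (intro sum.cong HOL.refl) simp
  qed
  show ?thesis
    unfolding dp_iB1_\<eta> 1
    by (simp add: endo_simps[OF endo_dp[OF endo_iB1]] 2 bcoeff_def scale_sum_right)
qed

end

section \<open>Linear independence\<close>

context simple_sl3_module
begin

lemma E1_pow_f1_f2_f1:
  assumes "c \<le> p" "c \<le> m" "p \<le> m + r"
  shows "(E1 ^^ p) (f1 (p - c) (f2 r (f1 c \<eta>))) =
    (qf p * qf (m + r - c) * qf m / (qf (p - c) * qf (m + r - p) * qf c * qf (m - c))) *s f2 r \<eta>"
  using assms
proof (induction p arbitrary: c)
  case 0
  then show ?case by simp
next
  case (Suc p)
  \<comment> \<open>The expected coefficient divided by \<open>[p+1][m+r-p]\<close>. The two terms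
    of \<open>E1_f1_f2_f1\<close> give \<open>?D\<close> times the two summands on the left of fact
    \<open>4\<close>.\<close>
  let ?D = "qf p * qf (m + r - c) * qf m / (qf (Suc p - c) * qf (m + r - p) * qf c * qf (m - c))"
  have endo: "endo (E1 ^^ p)" by (rule endo_funpow[OF endo_E1])
  have 1: "(E1 ^^ p) (if Suc p - c = 0 then 0 else
       qi (int m - 2 * int c + int r - int (Suc p - c) + 1) *s f1 (Suc p - c - 1) (f2 r (f1 c \<eta>))) =
     (?D * (qi (int m + int r - int p - int c) * qi (int (Suc p) - int c))) *s f2 r \<eta>"
  proof (cases "c = Suc p")
    case True
    then show ?thesis by (simp add: endo_simps[OF endo])
  next
    case False
    with Suc.prems have c: "c \<le> p" by simp
    define U Y where "U = qi (int m + int r - int p - int c)" and "Y = qi (int (Suc p) - int c)"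
    have Y: "qf (Suc p - c) = Y * qf (p - c)" "Y \<noteq> 0"
      using qf_Suc[of "p - c"] c by (simp_all add: Y_def Suc_diff_le of_nat_diff algebra_simps)
    have "int m - 2 * int c + int r - int (Suc p - c) + 1 = int m + int r - int p - int c"
      "Suc p - c - 1 = p - c" "Suc p - c \<noteq> 0" using c by auto
    then have "(if Suc p - c = 0 then 0 else
       qi (int m - 2 * int c + int r - int (Suc p - c) + 1) *s f1 (Suc p - c - 1) (f2 r (f1 c \<eta>))) =
       U *s f1 (p - c) (f2 r (f1 c \<eta>))"
      by (simp only: U_def if_False)
    then show ?thesis
      unfolding U_def[symmetric] Y_def[symmetric] Y(1)
      using Y(2) Suc.IH[OF c] Suc.prems by (simp add: endo_simps[OF endo] mult_ac)
  qed
  have 2: "(E1 ^^ p) (if c = 0 then 0 else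
       qi (int m - int c + 1) *s f1 (Suc p - c) (f2 r (f1 (c - 1) \<eta>))) =
     (?D * (qi (int m + int r - int c + 1) * qi (int c))) *s f2 r \<eta>"
  proof (cases c)
    case 0
    then show ?thesis by (simp add: endo_simps[OF endo])
  next
    case (Suc d)
    with Suc.prems have d: "d \<le> p" "d \<le> m" "p \<le> m + r" "Suc d \<le> m" by auto
    have "qf (m + r - d) = qi (int m + int r - int c + 1) * qf (m + r - c)"
      using qf_Suc[of "m + r - c"] d by (simp add: Suc Suc_diff_Suc of_nat_diff algebra_simps)
    moreover have "qf (m - d) = qi (int m - int c + 1) * qf (m - c)"
      using qf_Suc[of "m - c"] d by (simp add: Suc Suc_diff_Suc of_nat_diff algebra_simps)
    moreover have "qf c = qi (int c) * qf d"
      by (simp add: Suc qf_Suc add.commute)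
    moreover have "qi (int m - int c + 1) \<noteq> 0" "qi (int c) \<noteq> 0" using d Suc by simp_all
    moreover have "Suc p - c = p - d" "c - 1 = d" "c \<noteq> 0" using Suc by auto
    ultimately show ?thesis
      using Suc.IH[OF d(1-3)] by (simp add: endo_simps[OF endo] field_simps del: of_nat_Suc)
  qed
  have 3: "qf (m + r - p) = qi (int m + int r - int p) * qf (m + r - Suc p)"
    using qf_Suc[of "m + r - Suc p"] Suc.prems by (simp add: Suc_diff_Suc of_nat_diff algebra_simps)
  have 4: "qi (int m + int r - int p - int c) * qi (int (Suc p) - int c)
        + qi (int m + int r - int c + 1) * qi (int c)
      = qi (int (Suc p)) * qi (int m + int r - int p)"
    using qi_exchange[of "int m + int r - int p" "int c" "int (Suc p) - int c"]
    by (simp add: algebra_simps)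
  have 5: "qi (int m + int r - int p) \<noteq> 0" using Suc.prems by simp
  have "(E1 ^^ Suc p) (f1 (Suc p - c) (f2 r (f1 c \<eta>))) = (E1 ^^ p) (E1 (f1 (Suc p - c) (f2 r (f1 c \<eta>))))"
    by (simp add: funpow_swap1)
  also have "\<dots> = (?D * (qi (int (Suc p)) * qi (int m + int r - int p))) *s f2 r \<eta>"
    unfolding E1_f1_f2_f1[OF singular_\<eta>] module_hom.add[OF endo] 1 2 scale_left_distrib[symmetric]
      distrib_left[symmetric] 4 ..
  also have "?D * (qi (int (Suc p)) * qi (int m + int r - int p)) =
     qf (Suc p) * qf (m + r - c) * qf m / (qf (Suc p - c) * qf (m + r - Suc p) * qf c * qf (m - c))"
    unfolding 3 using 5 by (simp add: qf_Suc add.commute mult_ac)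
  finally show ?case .
qed

lemma E2_pow_f1_f2_f1:
  assumes "k \<le> b" "b \<le> n + c"
  shows "(E2 ^^ k) (f1 a (f2 b (f1 c \<eta>))) =
    (qf (n + c - b + k) / qf (n + c - b)) *s f1 a (f2 (b - k) (f1 c \<eta>))"
  using assms(1)
proof (induction k)
  case 0
  then show ?case by simp
next
  case (Suc k)
  define U where "U = qi (int n + int c - int (b - k) + 1)"
  have "int n + int c - int (b - k) + 1 = int (n + c - b + k) + 1"
    using Suc.prems assms(2) by linarith
  then have U: "qf (n + c - b + Suc k) = U * qf (n + c - b + k)"
    by (simp only: U_def qf_Suc add_Suc_right)
  have "E2 (f1 a (f2 (b - k) (f1 c \<eta>))) = U *s f1 a (f2 (b - Suc k) (f1 c \<eta>))"
    using Suc.prems unfolding U_def by (subst E2_f1_f2_f1[OF singular_\<eta>]) auto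
  then show ?case
    using Suc.IH Suc.prems by (simp only: U) (simp add: mult.commute)
qed

text \<open>Truncated subtraction makes the lower bound max(0, r-n). The test operators use
  \<open>k\<close> from the same interval as \<open>c\<close>, so the matrix is square and
  \<open>hankel_qf\<close> applies after the factors \<open>R\<close> and \<open>C\<close> are split
  off.\<close>

lemma independent_weight_block:
  assumes "p \<le> r" "(\<Sum>c\<in>{r - n..min m p}. l c *s f1 (p - c) (f2 r (f1 c \<eta>))) = 0"
    and "c \<in> {r - n..min m p}"
  shows "l c = 0"
proof -
  define c0 d where "c0 = r - n" and "d = min m p - c0"
  have le: "c0 + d \<le> m" "c0 + d \<le> p" "{r - n..min m p} = {c0..c0 + d}" "r \<le> n + c0"
    using assms(3) by (auto simp: c0_def d_def)
  \<comment> \<open>With \<open>c = c0 + i\<close> and \<open>k = c0 + j\<close> the two factorials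
    become those of \<open>hankel_qf\<close>; \<open>p \<le> r\<close> ensures that \<open>B\<close>
    is not truncated.\<close>
  define A B where "A = n + 2 * c0 - r" and "B = m + r - 2 * (c0 + d)"
  define C where "C = (\<lambda>c. qf m / (qf (n + c - r) * qf (p - c) * qf c * qf (m - c)))"
  define R where "R = (\<lambda>k. qf p * qf n / (qf (m + r - k - p) * qf (n + k - r)))"
  \<comment> \<open>\<open>E2 ^^ k\<close> lowers \<open>r\<close> to \<open>r - k\<close>,
    \<open>E1 ^^ p\<close> then leaves a multiple of \<open>f2 (r - k) \<eta>\<close>, and the last
    power returns to \<eta>.\<close>
  have functional: "(E2 ^^ (r - k)) ((E1 ^^ p) ((E2 ^^ k) (f1 (p - c) (f2 r (f1 c \<eta>))))) =
     (R k * C c * (qf (n + c - r + k) * qf (m + r - k - c))) *s \<eta>"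
    if "k \<in> {c0..c0 + d}" "c \<in> {c0..c0 + d}" for k c
  proof -
    have endos: "endo (E1 ^^ p)" "endo (E2 ^^ (r - k))"
      by (rule endo_funpow endo_E1 endo_E2)+
    have "k \<le> r" "r \<le> n + c" "c \<le> p" "c \<le> m" "p \<le> m + (r - k)" "r - k \<le> n"
      using that le(1,2,4) assms(1) unfolding atLeastAtMost_iff by linarith+
    moreover from this have "n - (r - k) = n + k - r" "m + (r - k) = m + r - k" by auto
    ultimately show ?thesis
      using E2_pow_f1_f2_f1[of "r - k" "r - k" 0 0]
      by (simp add: E2_pow_f1_f2_f1 E1_pow_f1_f2_f1 endo_simps[OF endos(1)] endo_simps[OF endos(2)]
          R_def C_def field_simps)
  qed
  have "(\<Sum>i\<le>d. (l (c0 + i) * C (c0 + i)) * (qf (A + i + j) * qf (B + 2 * d - i - j))) = 0"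
    if "j \<le> d" for j
  proof -
    let ?k = "c0 + j"
    let ?\<Phi> = "\<lambda>v. (E2 ^^ (r - ?k)) ((E1 ^^ p) ((E2 ^^ ?k) v))"
    have endo: "endo ?\<Phi>"
      by (intro endoI) (simp_all add: endo_simps[OF endo_funpow[OF endo_E1]] endo_simps[OF endo_funpow[OF endo_E2]])
    have "0 = ?\<Phi> (\<Sum>c\<in>{c0..c0 + d}. l c *s f1 (p - c) (f2 r (f1 c \<eta>)))"
      using assms(2) endo_simps(3)[OF endo] by (simp add: le)
    also have "\<dots> = (\<Sum>c\<in>{c0..c0 + d}. (l c * (R ?k * C c * (qf (n + c - r + ?k) * qf (m + r - ?k - c)))) *s \<eta>)"
      unfolding endo_simps(4)[OF endo] endo_simps(2)[OF endo]
      by (intro sum.cong HOL.refl) (simp add: functional that del: funpow.simps)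
    also have "\<dots> = (\<Sum>c\<in>{c0..c0 + d}. l c * (R ?k * C c * (qf (n + c - r + ?k) * qf (m + r - ?k - c)))) *s \<eta>"
      by (rule scale_sum_left[symmetric])
    finally have "(\<Sum>c\<in>{c0..c0 + d}. l c * (R ?k * C c * (qf (n + c - r + ?k) * qf (m + r - ?k - c)))) = 0"
      using \<eta>_nonzero by simp
    also have "(\<Sum>c\<in>{c0..c0 + d}. l c * (R ?k * C c * (qf (n + c - r + ?k) * qf (m + r - ?k - c)))) =
       (\<Sum>i\<le>d. l (c0 + i) * (R ?k * C (c0 + i) * (qf (n + (c0 + i) - r + ?k) * qf (m + r - ?k - (c0 + i)))))"
      by (rule sum.reindex_bij_witness[of _ "\<lambda>i. c0 + i" "\<lambda>c. c - c0"]) auto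
    also have "\<dots> = R ?k * (\<Sum>i\<le>d. (l (c0 + i) * C (c0 + i)) * (qf (A + i + j) * qf (B + 2 * d - i - j)))"
      unfolding sum_distrib_left
    proof (intro sum.cong HOL.refl)
      fix i assume "i \<in> {..d}"
      then have "n + (c0 + i) - r + ?k = A + i + j" "m + r - ?k - (c0 + i) = B + 2 * d - i - j"
        using le assms(1) that by (auto simp: A_def B_def)
      then show "l (c0 + i) * (R ?k * C (c0 + i) * (qf (n + (c0 + i) - r + ?k) * qf (m + r - ?k - (c0 + i)))) =
         R ?k * ((l (c0 + i) * C (c0 + i)) * (qf (A + i + j) * qf (B + 2 * d - i - j)))"
        by (simp only: mult_ac)
    qed
    finally show ?thesis by (simp add: R_def)
  qed
  from hankel_qf[OF this, of "c - c0"] assms(3) show ?thesis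
    unfolding le(3) by (auto simp: C_def)
qed

end

section \<open>Transfer of bases from the monomials in \<open>F1\<close>, \<open>F2\<close> to those
  in \<open>iB1\<close>, \<open>iB2\<close>\<close>

context vector_space
begin

text \<open>The family \<open>f\<close> only bounds the dimension below by the size of
  \<open>I\<close>. A repetition or a redundant member of \<open>g\<close> would yield a spanning
  set smaller than that.\<close>

lemma spanning_family_basis:
  assumes "finite I" "span (g ` I) = UNIV"
    and indep: "\<And>l i. (\<Sum>i\<in>I. scale (l i) (f i)) = 0 \<Longrightarrow> i \<in> I \<Longrightarrow> l i = 0"
  shows "independent (g ` I) \<and> inj_on g I"
proof -
  have inj: "inj_on f I"
  proof (rule inj_onI, rule ccontr)
    fix i j assume ij: "i \<in> I" "j \<in> I" "f i = f j" "i \<noteq> j"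
    define l :: "'c \<Rightarrow> 'a" where "l k = (if k = i then 1 else if k = j then -1 else 0)" for k
    have "(\<Sum>k\<in>I. scale (l k) (f k)) = (\<Sum>k\<in>{i, j}. scale (l k) (f k))"
      by (rule sum.mono_neutral_right) (use assms(1) ij in \<open>auto simp: l_def\<close>)
    also have "\<dots> = 0" using ij by (simp add: l_def)
    finally have "l i = 0" using indep ij by blast
    then show False by (simp add: l_def)
  qed
  have "independent (f ` I)"
  proof (rule independent_if_scalars_zero)
    fix l v assume *: "(\<Sum>x\<in>f ` I. scale (l x) x) = 0" "v \<in> f ` I"
    then show "l v = 0"
      using indep[of "\<lambda>i. l (f i)"] by (auto simp: sum.reindex[OF inj])
  qed (use assms in simp)
  then have bound: "card I \<le> card B" if "finite B" "span B = UNIV" for B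
    using independent_span_bound[of B "f ` I"] that card_image[OF inj] by simp
  have "card (g ` I) = card I"
    using bound[of "g ` I"] card_image_le[of I g] assms by simp
  then have "inj_on g I"
    by (rule eq_card_imp_inj_on[OF assms(1)])
  moreover have "independent (g ` I)"
  proof
    assume "dependent (g ` I)"
    then obtain x where x: "x \<in> g ` I" "x \<in> span (g ` I - {x})"
      unfolding dependent_def by blast
    then have "span (g ` I - {x}) = UNIV"
      using assms(2) span_redundant[of x "g ` I - {x}"] by (simp add: insert_absorb)
    then have "card I \<le> card (g ` I) - 1"
      using bound[of "g ` I - {x}"] x assms(1) by simp
    moreover have "card (g ` I) > 0" using x assms(1) by (auto simp: card_gt_0_iff)
    ultimately show False using \<open>card (g ` I) = card I\<close> by simp
  qed
  ultimately show ?thesis by simp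
qed

end

context simple_sl3_module
begin

text \<open>Strictness in the right summand counts the monomials with \<open>b = a + c\<close> once.
  Triples are listed from the outermost to the innermost factor in both summands.\<close>

definition index_set :: "(nat \<times> nat \<times> nat + nat \<times> nat \<times> nat) set" where
  "index_set = {(a, b, c). c \<le> m \<and> a + c \<le> b \<and> b \<le> n + c} <+> {(a, b, c). c \<le> n \<and> a + c < b \<and> b \<le> m + c}"

definition F_monomial :: "nat \<times> nat \<times> nat + nat \<times> nat \<times> nat \<Rightarrow> 'v" where
  "F_monomial = case_sum (\<lambda>(a, b, c). f1 a (f2 b (f1 c \<eta>))) (\<lambda>(a, b, c). f2 a (f1 b (f2 c \<eta>)))"

definition B_monomial :: "'k \<Rightarrow> 'k \<Rightarrow> nat \<times> nat \<times> nat + nat \<times> nat \<times> nat \<Rightarrow> 'v" where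
  "B_monomial s1 s2 = case_sum (\<lambda>(a, b, c). dp (iB1 s1) a (dp (iB2 s2) b (dp (iB1 s1) c \<eta>)))
     (\<lambda>(a, b, c). dp (iB2 s2) a (dp (iB1 s1) b (dp (iB2 s2) c \<eta>)))"

text \<open>The multiplicities of the two simple roots in the difference between the highest weight
  and the weight of the monomial in \<open>F1\<close>, \<open>F2\<close>.\<close>

definition depth :: "nat \<times> nat \<times> nat + nat \<times> nat \<times> nat \<Rightarrow> nat \<times> nat" where
  "depth = case_sum (\<lambda>(a, b, c). (a + c, b)) (\<lambda>(a, b, c). (b, a + c))"

lemma finite_index_set: "finite index_set"
proof -
  have "{(a, b, c). c \<le> m \<and> a + c \<le> b \<and> b \<le> n + c} \<subseteq> {..n + m} \<times> {..n + m} \<times> {..m}"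
    "{(a, b, c). c \<le> n \<and> a + c < b \<and> b \<le> m + c} \<subseteq> {..m + n} \<times> {..m + n} \<times> {..n}"
    by auto
  then show ?thesis
    unfolding index_set_def by (meson finite_Plus finite_SigmaI finite_atMost finite_subset)
qed

lemma wt_F_monomial: "wt (int m - 2 * int (fst (depth i)) + int (snd (depth i)))
    (int n - 2 * int (snd (depth i)) + int (fst (depth i))) (F_monomial i)"
proof (cases i)
  case (Inl t)
  obtain a b c where t: "t = (a, b, c)" by (cases t)
  show ?thesis
    using wt_f1[OF wt_f2[OF wt_f1[OF wt_\<eta>]], of c b a]
    by (simp add: Inl t F_monomial_def depth_def algebra_simps)
next
  case (Inr t)
  obtain a b c where t: "t = (a, b, c)" by (cases t)
  show ?thesis
    using wt_f2[OF wt_f1[OF wt_f2[OF wt_\<eta>]], of c b a]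
    by (simp add: Inr t F_monomial_def depth_def algebra_simps)
qed

text \<open>Weights determine \<open>depth\<close>, so \<open>wt_sum_eq_0\<close> isolates one block
  \<open>(p, r)\<close>. A block lies entirely in the left summand if \<open>p \<le> r\<close> and
  in the right one if \<open>r < p\<close>; hence \<open>independent_weight_block\<close> or its
  flip finishes.\<close>

lemma F_monomial_independent:
  assumes "(\<Sum>i\<in>index_set. l i *s F_monomial i) = 0" "i \<in> index_set"
  shows "l i = 0"
proof -
  obtain p r where pr: "depth i = (p, r)" by (cases "depth i")
  let ?J = "{j \<in> index_set. depth j = (p, r)}"
  let ?v = "\<Sum>j\<in>?J. l j *s F_monomial j"
  have v: "?v = (\<Sum>j\<in>index_set - ?J. - l j *s F_monomial j)"
  proof -
    have "(\<Sum>j\<in>index_set - ?J. l j *s F_monomial j) + ?v = 0"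
      using assms(1) sum.subset_diff[of ?J index_set "\<lambda>j. l j *s F_monomial j"] finite_index_set by simp
    then show ?thesis
      by (simp add: sum_negf eq_neg_iff_add_eq_0 add.commute)
  qed
  have block: "?v = 0"
  proof (rule wt_sum_eq_0[OF _ _ _ v])
    show "finite (index_set - ?J)" using finite_index_set by simp
    show "wt (int m - 2 * int p + int r) (int n - 2 * int r + int p) ?v"
      using wt_F_monomial by (intro wt_sum wt_scale) (metis (mono_tags, lifting) fst_conv mem_Collect_eq snd_conv)
    show "wt (int m - 2 * int (fst (depth j)) + int (snd (depth j)))
        (int n - 2 * int (snd (depth j)) + int (fst (depth j))) (- l j *s F_monomial j) \<and>
      (int m - 2 * int (fst (depth j)) + int (snd (depth j)),
        int n - 2 * int (snd (depth j)) + int (fst (depth j))) \<noteq>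
      (int m - 2 * int p + int r, int n - 2 * int r + int p)" if "j \<in> index_set - ?J" for j
    proof (intro conjI wt_scale wt_F_monomial)
      have "depth j \<noteq> (p, r)" using that by auto
      then show "(int m - 2 * int (fst (depth j)) + int (snd (depth j)),
        int n - 2 * int (snd (depth j)) + int (fst (depth j))) \<noteq>
      (int m - 2 * int p + int r, int n - 2 * int r + int p)"
        by (cases "depth j") auto
    qed
  qed
  show ?thesis
  proof (cases i)
    case (Inl t)
    then obtain a c where i: "i = Inl (a, r, c)" "p = a + c"
      using pr by (cases t) (auto simp: depth_def)
    with assms(2) have ineqs: "p \<le> r" "c \<in> {r - n..min m p}" by (auto simp: index_set_def)
    have "?J = (\<lambda>c. Inl (p - c, r, c)) ` {r - n..min m p}"
      using ineqs(1) by (auto simp: index_set_def depth_def image_iff)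
    then have "(\<Sum>c\<in>{r - n..min m p}. l (Inl (p - c, r, c)) *s f1 (p - c) (f2 r (f1 c \<eta>))) = 0"
      using block by (simp add: sum.reindex inj_on_def F_monomial_def)
    from independent_weight_block[OF ineqs(1) this ineqs(2)] i show ?thesis by simp
  next
    case (Inr t)
    then obtain a c where i: "i = Inr (a, p, c)" "r = a + c"
      using pr by (cases t) (auto simp: depth_def)
    with assms(2) have ineqs: "r < p" "c \<in> {p - m..min n r}" by (auto simp: index_set_def)
    have "?J = (\<lambda>c. Inr (r - c, p, c)) ` {p - m..min n r}"
      using ineqs(1) by (auto simp: index_set_def depth_def image_iff)
    then have "(\<Sum>c\<in>{p - m..min n r}. l (Inr (r - c, p, c)) *s f2 (r - c) (f1 p (f2 c \<eta>))) = 0"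
      using block by (simp add: sum.reindex inj_on_def F_monomial_def)
    from simple_sl3_module.independent_weight_block[OF simple_sl3_module_flip _ this ineqs(2)] ineqs(1) i
    show ?thesis by simp
  qed
qed

text \<open>All monomials span by irreducibility. Those outside \<open>index_set\<close> vanish, or
  belong to the second family with \<open>b = a + c\<close> and are rewritten by
  \<open>dp_braid\<close>.\<close>

lemma span_F_monomial: "span (F_monomial ` index_set) = UNIV"
proof -
  have P: "f1 a (f2 b (f1 c \<eta>)) \<in> insert 0 (F_monomial ` index_set)" if "a + c \<le> b" for a b c
  proof (cases "c \<le> m \<and> b \<le> n + c")
    case True
    then have "Inl (a, b, c) \<in> index_set" using that by (auto simp: index_set_def)
    then show ?thesis by (force simp: F_monomial_def)
  next
    case False
    then show ?thesis using f1_f2_f1_\<eta>_eq_0[of c b a] by auto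
  qed
  have Q: "f2 a (f1 b (f2 c \<eta>)) \<in> insert 0 (F_monomial ` index_set)" if "a + c \<le> b" for a b c
  proof (cases "a + c = b")
    case True
    then show ?thesis using P[of c a "c + a"] dp_braid[of c a \<eta>] by (simp add: add.commute)
  next
    case less: False
    show ?thesis
    proof (cases "c \<le> n \<and> b \<le> m + c")
      case True
      then have "Inr (a, b, c) \<in> index_set" using that less by (auto simp: index_set_def)
      then show ?thesis by (force simp: F_monomial_def)
    next
      case False
      then show ?thesis
        using simple_sl3_module.f1_f2_f1_\<eta>_eq_0[OF simple_sl3_module_flip, of c b a] by auto
    qed
  qed
  have "monomials \<eta> \<subseteq> insert 0 (F_monomial ` index_set)" using P Q unfolding monomials_def by blast
  then have "span (monomials \<eta>) \<subseteq> span (F_monomial ` index_set)"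
    using span_mono[of "monomials \<eta>" "insert 0 (F_monomial ` index_set)"] by simp
  then show ?thesis using span_monomials_nonzero_singular[OF singular_\<eta> \<eta>_nonzero] by auto
qed

text \<open>Solves \<open>dp_iB_expansion\<close> for its leading term, whose coefficient is
  \<open>1\<close> by \<open>bcoeff_0\<close>.\<close>

lemma dp_iB_lower_terms:
  assumes "a + c \<le> b" "subspace W" "dp (iB1 s1) a (dp (iB2 s2) b (dp (iB1 s1) c \<eta>)) \<in> W"
    and "\<And>i j. i \<le> c \<Longrightarrow> j \<le> a \<Longrightarrow> 0 < i + j \<Longrightarrow> f1 (a - j) (f2 (b - i - j) (f1 (c - i) \<eta>)) \<in> W"
  shows "f1 a (f2 b (f1 c \<eta>)) \<in> W"
proof -
  let ?t = "\<lambda>(i, j). bcoeff s1 s2 a b c i j *s f1 (a - j) (f2 (b - i - j) (f1 (c - i) \<eta>))"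
  let ?R = "({..c} \<times> {..a}) - {(0, 0)}"
  have "dp (iB1 s1) a (dp (iB2 s2) b (dp (iB1 s1) c \<eta>)) = (\<Sum>x\<in>{..c} \<times> {..a}. ?t x)"
    unfolding dp_iB_expansion[OF assms(1)] sum.cartesian_product ..
  also have "\<dots> = ?t (0, 0) + (\<Sum>x\<in>?R. ?t x)"
    by (rule sum.remove) auto
  finally have "f1 a (f2 b (f1 c \<eta>)) =
      dp (iB1 s1) a (dp (iB2 s2) b (dp (iB1 s1) c \<eta>)) - (\<Sum>x\<in>?R. ?t x)"
    by simp
  moreover have "(\<Sum>x\<in>?R. ?t x) \<in> W"
  proof (rule subspace_sum[OF assms(2)])
    fix x assume x: "x \<in> ?R"
    obtain i j where ij: "x = (i, j)" by (cases x)
    with x have "i \<le> c" "j \<le> a" "0 < i + j" by auto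
    then show "?t x \<in> W"
      unfolding ij prod.case by (intro subspace_scale[OF assms(2)] assms(4))
  qed
  ultimately show ?thesis using subspace_diff[OF assms(2,3)] by simp
qed

text \<open>Induction on the sum of the two entries of \<open>depth\<close>. Each lower term
  decreases both \<open>a + c\<close> and \<open>b\<close> by \<open>i + j\<close>, so it satisfies
  the inequalities of its own family and comes earlier.\<close>

lemma span_B_monomial: "span (B_monomial s1 s2 ` index_set) = UNIV"
proof -
  have "F_monomial x \<in> span (B_monomial s1 s2 ` index_set)" if "x \<in> index_set" "fst (depth x) + snd (depth x) = N" for x N
    using that
  proof (induction N arbitrary: x rule: less_induct)
    case (less N)
    have B: "B_monomial s1 s2 x \<in> span (B_monomial s1 s2 ` index_set)"
      using less.prems by (intro span_base) auto
    show ?case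
    proof (cases x)
      case (Inl t)
      then obtain a b c where x: "x = Inl (a, b, c)" by (cases t) auto
      have le: "c \<le> m" "a + c \<le> b" "b \<le> n + c" "a + c + b = N"
        using less.prems unfolding x by (auto simp: index_set_def depth_def)
      have "f1 a (f2 b (f1 c \<eta>)) \<in> span (B_monomial s1 s2 ` index_set)"
      proof (rule dp_iB_lower_terms[OF le(2) subspace_span])
        show "dp (iB1 s1) a (dp (iB2 s2) b (dp (iB1 s1) c \<eta>)) \<in> span (B_monomial s1 s2 ` index_set)"
          using B by (simp add: B_monomial_def x)
        fix i j assume ij: "i \<le> c" "j \<le> a" "0 < i + j"
        show "f1 (a - j) (f2 (b - i - j) (f1 (c - i) \<eta>)) \<in> span (B_monomial s1 s2 ` index_set)"
        proof -
          let ?x = "Inl (a - j, b - i - j, c - i)"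
          have "?x \<in> index_set" using ij le by (auto simp: index_set_def)
          moreover have "fst (depth ?x) + snd (depth ?x) < N" using ij le by (auto simp: depth_def)
          ultimately have "F_monomial ?x \<in> span (B_monomial s1 s2 ` index_set)" using less.IH by blast
          then show ?thesis by (simp add: F_monomial_def)
        qed
      qed
      then show ?thesis by (simp add: F_monomial_def x)
    next
      case (Inr t)
      then obtain a b c where x: "x = Inr (a, b, c)" by (cases t) auto
      have le: "c \<le> n" "a + c < b" "b \<le> m + c" "a + c + b = N"
        using less.prems unfolding x by (auto simp: index_set_def depth_def)
      have "f2 a (f1 b (f2 c \<eta>)) \<in> span (B_monomial s1 s2 ` index_set)"
      proof (rule simple_sl3_module.dp_iB_lower_terms[OF simple_sl3_module_flip less_imp_le[OF le(2)] subspace_span])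
        show "dp (iB2 s2) a (dp (iB1 s1) b (dp (iB2 s2) c \<eta>)) \<in> span (B_monomial s1 s2 ` index_set)"
          using B by (simp add: B_monomial_def x)
        fix i j assume ij: "i \<le> c" "j \<le> a" "0 < i + j"
        show "f2 (a - j) (f1 (b - i - j) (f2 (c - i) \<eta>)) \<in> span (B_monomial s1 s2 ` index_set)"
        proof -
          let ?x = "Inr (a - j, b - i - j, c - i)"
          have "?x \<in> index_set" using ij le by (auto simp: index_set_def)
          moreover have "fst (depth ?x) + snd (depth ?x) < N" using ij le by (auto simp: depth_def)
          ultimately have "F_monomial ?x \<in> span (B_monomial s1 s2 ` index_set)" using less.IH by blast
          then show ?thesis by (simp add: F_monomial_def)
        qed
      qed
      then show ?thesis by (simp add: F_monomial_def x)
    qed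
  qed
  then have "F_monomial ` index_set \<subseteq> span (B_monomial s1 s2 ` index_set)" by blast
  then have "span (F_monomial ` index_set) \<subseteq> span (B_monomial s1 s2 ` index_set)"
    by (rule span_minimal) (rule subspace_span)
  then show ?thesis using span_F_monomial by auto
qed

lemma B_monomial_basis: "independent (B_monomial s1 s2 ` index_set)" "inj_on (B_monomial s1 s2) index_set"
  using spanning_family_basis[OF finite_index_set span_B_monomial, of F_monomial] F_monomial_independent by blast+

text \<open>Inside the index range both sides are members of bases. Outside it both vanish: if
  \<open>b > n + c\<close>, every term of \<open>dp_iB2\<close> still has
  \<open>b - i > n + (c - i)\<close>.\<close>

lemma dp_iB_eq_0_iff:
  assumes "a + c \<le> b"
  shows "dp (iB1 s1) a (dp (iB2 s2) b (dp (iB1 s1) c \<eta>)) = 0 \<longleftrightarrow> f1 a (f2 b (f1 c \<eta>)) = 0"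
proof (cases "c \<le> m \<and> b \<le> n + c")
  case True
  then have i: "Inl (a, b, c) \<in> index_set" using assms by (auto simp: index_set_def)
  have "F_monomial (Inl (a, b, c)) \<noteq> 0"
    using spanning_family_basis[OF finite_index_set span_F_monomial, of F_monomial] F_monomial_independent i
    by (metis (no_types, lifting) dependent_zero imageI)
  moreover have "B_monomial s1 s2 (Inl (a, b, c)) \<noteq> 0"
    using B_monomial_basis(1)[of s1 s2] i by (metis (no_types, lifting) dependent_zero imageI)
  ultimately show ?thesis by (simp add: F_monomial_def B_monomial_def)
next
  case False
  have "dp (iB2 s2) b (f1 c \<eta>) = 0"
  proof (cases "c \<le> m")
    case True
    then show ?thesis
      unfolding dp_iB2[OF wt_f1[OF wt_\<eta>]] e1_f1[OF wt_\<eta> E1_\<eta>]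
      using False by (intro sum.neutral ballI) (auto simp: f2_f1_\<eta>_eq_0)
  next
    case False
    then show ?thesis by (simp add: f1_\<eta>_eq_0 endo_simps[OF endo_dp[OF endo_iB2]])
  qed
  then show ?thesis
    using False f1_f2_f1_\<eta>_eq_0[of c b a]
    by (auto simp: dp_iB1_\<eta> endo_simps[OF endo_dp[OF endo_iB1]])
qed

text \<open>The two expansions are matched term by term by exchanging \<open>i\<close> and
  \<open>j\<close>. The exponents of \<open>q\<close> agree only as sums of two \<open>bexp\<close>,
  and \<open>(a + c) - i - j = (a - j) + (c - i)\<close> lets \<open>dp_braid\<close> match the
  monomials.\<close>

lemma dp_iB_braid:
  "dp (iB1 s1) a (dp (iB2 s2) (a + c) (dp (iB1 s1) c \<eta>)) =
   dp (iB2 s2) c (dp (iB1 s1) (a + c) (dp (iB2 s2) a \<eta>))"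
proof -
  interpret flip: simple_sl3_module q scale E2 E1 F2 F1 K2 K1 J2 J1 n m \<eta>
    by (rule simple_sl3_module_flip)
  have bexp: "bexp (a + c) i (int n + int c) + bexp a j (int m - 2 * int c + int (a + c) + int i) =
      bexp (a + c) j (int m + int a) + bexp c i (int n - 2 * int a + int (a + c) + int j)" for i j
    by (simp add: bexp_def algebra_simps)
  have coeff: "bcoeff s1 s2 a (a + c) c i j = flip.bcoeff s2 s1 c (a + c) a j i" for i j
  proof -
    have "bcoeff s1 s2 a (a + c) c i j = s2 ^ i * s1 ^ j * qbin (int m - int c) i * qbin (int n - int a) j *
       q powi (bexp (a + c) i (int n + int c) + bexp a j (int m - 2 * int c + int (a + c) + int i))"
      using q_nonzero by (simp add: bcoeff_def power_int_add)
    also have "\<dots> = flip.bcoeff s2 s1 c (a + c) a j i"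
      unfolding bexp using q_nonzero by (simp add: flip.bcoeff_def power_int_add)
    finally show ?thesis .
  qed
  have F: "f1 (a - j) (f2 (a + c - i - j) (f1 (c - i) \<eta>)) = f2 (c - i) (f1 (a + c - j - i) (f2 (a - j) \<eta>))"
    if "i \<le> c" "j \<le> a" for i j
  proof -
    have "a + c - i - j = (a - j) + (c - i)" "a + c - j - i = (a - j) + (c - i)"
      using that by auto
    then show ?thesis by (simp only: dp_braid)
  qed
  have "dp (iB1 s1) a (dp (iB2 s2) (a + c) (dp (iB1 s1) c \<eta>)) =
    (\<Sum>j\<le>a. \<Sum>i\<le>c. bcoeff s1 s2 a (a + c) c i j *s f1 (a - j) (f2 (a + c - i - j) (f1 (c - i) \<eta>)))"
    unfolding dp_iB_expansion[OF order_refl] by (rule sum.swap)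
  also have "\<dots> = (\<Sum>j\<le>a. \<Sum>i\<le>c. flip.bcoeff s2 s1 c (a + c) a j i *s f2 (c - i) (f1 (a + c - j - i) (f2 (a - j) \<eta>)))"
    by (intro sum.cong HOL.refl) (simp only: F coeff atMost_iff)
  also have "\<dots> = dp (iB2 s2) c (dp (iB1 s1) (a + c) (dp (iB2 s2) a \<eta>))"
    by (rule flip.dp_iB_expansion[symmetric]) simp
  finally show ?thesis .
qed

end

section \<open>The quantum group and its simple modules\<close>

lemma Fract_power: "Fract a 1 ^ k = Fract (a ^ k) 1"
  by (induction k) (simp_all add: One_fract_def)

text \<open>Since \<open>to_ac\<close> is injective, a relation would already hold between
  polynomials, contradicting their degrees.\<close>

lemma qq_power_neq_1: "k > 0 \<Longrightarrow> qq ^ k \<noteq> 1"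
proof
  assume k: "k > 0" "qq ^ k = 1"
  then have "to_ac (Fract ([:0, 1:] ^ k) 1) = to_ac (Fract 1 1 :: rat poly fract)"
    by (simp add: qq_def Fract_power flip: to_ac_power One_fract_def)
  then have "([:0, 1:] :: rat poly) ^ k = 1"
    by (simp add: eq_fract)
  then have "degree (([:0, 1:] :: rat poly) ^ k) = 0"
    by simp
  with k(1) show False by (simp add: degree_power_eq)
qed

lemma generic_q_qq: "generic_q qq"
proof
  show "qq \<noteq> 0" using qq_power_neq_1[of 1] by (auto simp: qq_def Zero_fract_def eq_fract)
qed (rule qq_power_neq_1)

interpretation qq: generic_q qq by (rule generic_q_qq)

lemma qint_eq_qi: "qint r = qq.qi (int r)"
  by (simp add: qint_def qq.qi_def power_int_minus power_inverse)

lemma qfact_eq_qf: "qfact r = qq.qf r"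
  by (simp add: qfact_def qq.qf_def qint_eq_qi)

text \<open>Centrality of the scalars yields \<open>act_scale\<close>, hence linearity of every
  \<open>act x\<close>.\<close>

lemma uconst_commute: "uconst c * x = x * uconst c"
proof (transfer)
  fix c and x :: uq_free
  have "fconst c * x = x * fconst c"
    by (induction x rule: uq_free_induct)
      (simp_all add: distrib_left distrib_right mult_single mult.commute)
  then show "uq_cong (fconst c * x) (x * fconst c)" by (simp add: uq_cong.refl)
qed

lemma uKinv_uK: "uKinv a * uK a = 1"
  by (transfer, rule uq_cong.base, rule uq_relation.intros)

lemma uK_uE: "uK a * uE b = uconst (qq powi cartan a b) * uE b * uK a"
  by (transfer, rule uq_cong.base, rule uq_relation.intros)

lemma uK_uF: "uK a * uF b = uconst (qq powi (- cartan a b)) * uF b * uK a"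
  by (transfer, rule uq_cong.base, rule uq_relation.intros)

lemma uE_uF_same: "uE a * uF a - uF a * uE a = uconst (1 / (qq - inverse qq)) * (uK a - uKinv a)"
  by (transfer, rule uq_cong.base, rule uq_relation.E_F[of a a for a, simplified])

lemma uE_uF_distinct: "a \<noteq> b \<Longrightarrow> uE a * uF b - uF b * uE a = 0"
proof transfer
  fix a b :: node
  assume "a \<noteq> b"
  then show "uq_cong (fgen (GE a) * fgen (GF b) - fgen (GF b) * fgen (GE a)) 0"
    using uq_cong.base[OF uq_relation.E_F[of a b]] by simp
qed

lemma uF_serre: "a \<noteq> b \<Longrightarrow>
    uF a ^ 2 * uF b - uconst (qint 2) * uF a * uF b * uF a + uF b * uF a ^ 2 = 0"
  unfolding power2_eq_square
  by transfer (rule uq_cong.base, rule uq_relation.Serre_F[unfolded power2_eq_square])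

text \<open>Allows passing from stability under the generators to stability under the whole algebra.
  Representatives are built up from words and scalars.\<close>

lemma uq_generator_induct:
  assumes "\<And>c. P (uconst c)" "\<And>x y. P x \<Longrightarrow> P y \<Longrightarrow> P (x + y)" "\<And>x y. P x \<Longrightarrow> P y \<Longrightarrow> P (x * y)"
    and "\<And>a. P (uE a)" "\<And>a. P (uF a)" "\<And>a. P (uK a)" "\<And>a. P (uKinv a)"
  shows "P x"
proof -
  have abs_gen: "P (abs_uq (fgen g))" for g
    using assms(4-7) by (cases g) (simp_all add: uE.abs_eq uF.abs_eq uK.abs_eq uKinv.abs_eq flip: uE_def)
  have word: "P (abs_uq (Poly_Mapping.single (FWord l) 1))" for l
  proof (induction l)
    case Nil
    show ?case using assms(1)[of 1] by (simp add: uconst.abs_eq zero_fmonoid_def)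
  next
    case (Cons g l)
    have "Poly_Mapping.single (FWord (g # l)) 1 = fgen g * Poly_Mapping.single (FWord l) 1"
      by (simp add: mult_single plus_fmonoid_def)
    then show ?case
      using assms(3)[OF abs_gen Cons] by (simp add: times_uq.abs_eq)
  qed
  have "P (abs_uq y)" for y
  proof (induction y rule: uq_free_induct)
    case 1
    show ?case using assms(1)[of 0] by (simp add: uconst.abs_eq)
  next
    case (2 y w c)
    have "Poly_Mapping.single w c = fconst c * Poly_Mapping.single (FWord (letters w)) 1"
      by (simp add: mult_single)
    then have "P (abs_uq (Poly_Mapping.single w c))"
      using assms(3)[OF assms(1)[of c] word[of "letters w"]] by (simp add: times_uq.abs_eq uconst.abs_eq)
    from assms(2)[OF 2 this] show ?case by (simp add: plus_uq.abs_eq)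
  qed
  from this[of "rep_uq x"] show ?thesis
    by (simp add: Quotient_abs_rep[OF Quotient_uq])
qed

context uq_module
begin

lemma act_scale: "act x (scale c v) = scale c (act x v)"
  using act_mult[of "uconst c" x v] act_mult[of x "uconst c" v] by (simp add: uconst_commute act_const)

lemma act_zero_left: "act 0 v = 0"
  using act_add_left[of 0 0 v] by simp

lemma act_diff_left: "act (x - y) v = act x v - act y v"
  using act_add_left[of "x - y" y v] by (simp add: algebra_simps)

lemma act_endo: "module_hom scale scale (act x)"
  by unfold_locales (simp_all add: act_add_right act_scale)

lemma sl3_module_act: "sl3_module qq scale (act (uE N1)) (act (uE N2)) (act (uF N1)) (act (uF N2))
    (act (uK N1)) (act (uK N2)) (act (uKinv N1)) (act (uKinv N2))"
proof -
  note acts = act_mult act_const act_one act_scale act_diff_left act_add_left act_zero_left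
  have KinvK: "act (uKinv a) (act (uK a) v) = v" for a v
    by (simp add: acts uKinv_uK flip: act_mult)
  have KE: "act (uK a) (act (uE b) v) = scale (qq powi cartan a b) (act (uE b) (act (uK a) v))" for a b v
    using arg_cong[OF uK_uE, of "\<lambda>x. act x v"] by (simp add: acts)
  have KF: "act (uK a) (act (uF b) v) = scale (qq powi (- cartan a b)) (act (uF b) (act (uK a) v))" for a b v
    using arg_cong[OF uK_uF, of "\<lambda>x. act x v"] by (simp add: acts)
  have EF: "act (uE a) (act (uF a) v) - act (uF a) (act (uE a) v)
      = scale (1 / (qq - inverse qq)) (act (uK a) v - act (uKinv a) v)" for a v
    using arg_cong[OF uE_uF_same, of "\<lambda>x. act x v"] by (simp add: acts)
  have EF': "act (uE a) (act (uF b) v) = act (uF b) (act (uE a) v)" if "a \<noteq> b" for a b v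
    using arg_cong[OF uE_uF_distinct[OF that], of "\<lambda>x. act x v"] by (simp add: acts)
  have serre: "act (uF a) (act (uF a) (act (uF b) v)) + act (uF b) (act (uF a) (act (uF a) v))
      = scale (qq.qi 2) (act (uF a) (act (uF b) (act (uF a) v)))" if "a \<noteq> b" for a b v
    using arg_cong[OF uF_serre[OF that], of "\<lambda>x. act x v"]
    by (simp add: acts power2_eq_square qint_eq_qi algebra_simps)
  show ?thesis
    by (intro sl3_module.intro sl3_module_axioms.intro generic_q_vector_space.intro generic_q_qq
        vector_space_axioms act_endo KinvK EF EF' serre) (simp_all add: KE KF)
qed

end

context simple_uq_module_L
begin

lemma simple_sl3_module_act:
  assumes "highest_weight_vector m n \<eta>"
  shows "simple_sl3_module qq scale (act (uE N1)) (act (uE N2)) (act (uF N1)) (act (uF N2))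
    (act (uK N1)) (act (uK N2)) (act (uKinv N1)) (act (uKinv N2)) m n \<eta>"
proof -
  interpret sl3: sl3_module qq scale "act (uE N1)" "act (uE N2)" "act (uF N1)" "act (uF N2)"
    "act (uK N1)" "act (uK N2)" "act (uKinv N1)" "act (uKinv N2)"
    by (rule sl3_module_act)
  show ?thesis
  proof (rule simple_sl3_module.intro[OF sl3_module_act], rule simple_sl3_module_axioms.intro)
    show "\<eta> \<noteq> 0" "sl3.singular (int m) (int n) \<eta>"
      using assms by (auto simp: highest_weight_vector_def sl3.singular_def sl3.wt_def)
    fix W assume W: "sl3.invariant W"
    then have sub: "subspace W" by (simp add: sl3.invariant_def)
    have "\<forall>w\<in>W. act x w \<in> W" for x
    proof (induction x rule: uq_generator_induct)
      case (1 c)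
      then show ?case using subspace_scale[OF sub] by (simp add: act_const)
    next
      case (2 x y)
      then show ?case using subspace_add[OF sub] by (simp add: act_add_left)
    next
      case (3 x y)
      then show ?case by (simp add: act_mult)
    next
      case (4 a)
      then show ?case using W by (cases a) (simp_all add: sl3.invariant_def)
    next
      case (5 a)
      then show ?case using W by (cases a) (simp_all add: sl3.invariant_def)
    next
      case (6 a)
      then show ?case using W by (cases a) (simp_all add: sl3.invariant_def)
    next
      case (7 a)
      then show ?case using W by (cases a) (simp_all add: sl3.invariant_def)
    qed
    with sub have "uq_submodule W" by (simp add: uq_submodule_def)
    with simple show "W = {0} \<or> W = UNIV" by (simp add: simple_module_def)
  qed
qed

end

theorem theorem5p12:
  fixes scale :: "qfield \<Rightarrow> 'v::ab_group_add \<Rightarrow> 'v"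
    and act :: "uq \<Rightarrow> 'v \<Rightarrow> 'v"
    and m n :: nat
    and \<sigma>\<^sub>1 \<sigma>\<^sub>2 :: qfield
    and \<eta> :: 'v
  assumes "\<sigma>\<^sub>1 \<noteq> 0" and "\<sigma>\<^sub>2 \<noteq> 0"
    and "simple_uq_module_L scale act m n"
    and "uq_module.highest_weight_vector scale act m n \<eta>"
  defines "v \<equiv> \<lambda>(a, b, c). act (divpow (B1 \<sigma>\<^sub>1) a * divpow (B2 \<sigma>\<^sub>2) b * divpow (B1 \<sigma>\<^sub>1) c) \<eta>"
    and "w \<equiv> \<lambda>(a, b, c). act (divpow (B2 \<sigma>\<^sub>2) c * divpow (B1 \<sigma>\<^sub>1) b * divpow (B2 \<sigma>\<^sub>2) a) \<eta>"
    and "S \<equiv> {(a, b, c). c \<le> m \<and> int a \<le> int b - int c \<and> int b - int c \<le> int n}"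
    and "T \<equiv> {(a, b, c). a \<le> n \<and> int c \<le> int b - int a \<and> int b - int a \<le> int m}"
  shows "(\<forall>a b c. a + c \<le> b \<longrightarrow>
            (act (divpow (B1 \<sigma>\<^sub>1) a * divpow (B2 \<sigma>\<^sub>2) b * divpow (B1 \<sigma>\<^sub>1) c) \<eta> = 0 \<longleftrightarrow>
             act (divpow (uF N1) a * divpow (uF N2) b * divpow (uF N1) c) \<eta> = 0)) \<and>
         uq_module.is_basis scale (v ` S \<union> w ` T) \<and>
         inj_on v S \<and> inj_on w T \<and>
         (\<forall>(a, b, c) \<in> S. b = a + c \<longrightarrow> v (a, b, c) = w (a, b, c)) \<and>
         (\<forall>s\<in>S. \<forall>t\<in>T. v s = w t \<longrightarrow> s = t \<and> (case s of (a, b, c) \<Rightarrow> b = a + c))"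
proof -
  interpret simple_uq_module_L scale act m n by fact
  let ?E1 = "act (uE N1)" and ?E2 = "act (uE N2)" and ?F1 = "act (uF N1)" and ?F2 = "act (uF N2)"
    and ?J1 = "act (uKinv N1)" and ?J2 = "act (uKinv N2)"
  interpret L: simple_sl3_module qq scale ?E1 ?E2 ?F1 ?F2 "act (uK N1)" "act (uK N2)" ?J1 ?J2 m n \<eta>
    by (rule simple_sl3_module_act) fact
  have act_power: "act (x ^ r) u = (act x ^^ r) u" for x r u
    by (induction r) (simp_all add: act_one act_mult)
  have act_divpow: "act (divpow x r) = L.dp (act x) r" for x r
    by (rule ext) (simp add: divpow_def L.dp_def act_mult act_const act_power qfact_eq_qf)
  have B1: "act (B1 \<sigma>\<^sub>1) = L.iB1 \<sigma>\<^sub>1" and B2: "act (B2 \<sigma>\<^sub>2) = L.iB2 \<sigma>\<^sub>2"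
    by (rule ext, simp add: B1_def B2_def L.iB_def act_add_left act_mult act_const)+
  \<comment> \<open>The second family of the theorem lists its exponents from the innermost factor
    outwards, opposite to \<open>index_set\<close>.\<close>
  let ?r = "\<lambda>(a, b, c). (c, b, a)"
  let ?b = "L.B_monomial \<sigma>\<^sub>1 \<sigma>\<^sub>2"
  have v: "v (a, b, c) = L.dp (L.iB1 \<sigma>\<^sub>1) a (L.dp (L.iB2 \<sigma>\<^sub>2) b (L.dp (L.iB1 \<sigma>\<^sub>1) c \<eta>))"
    and w: "w (a, b, c) = L.dp (L.iB2 \<sigma>\<^sub>2) c (L.dp (L.iB1 \<sigma>\<^sub>1) b (L.dp (L.iB2 \<sigma>\<^sub>2) a \<eta>))" for a b c
    by (simp_all add: v_def w_def act_mult act_divpow B1 B2)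
  have vb: "v s = ?b (Inl s)" and wb: "w s = ?b (Inr (?r s))" for s
    by (cases s; simp add: v w L.B_monomial_def)+
  have braid: "v (a, a + c, c) = w (a, a + c, c)" for a c
    unfolding v w by (rule L.dp_iB_braid)
  have S: "s \<in> S \<longleftrightarrow> Inl s \<in> L.index_set" for s
    by (cases s) (auto simp: S_def L.index_set_def)
  \<comment> \<open>The strict part of \<open>T\<close> is the right summand of
    \<open>index_set\<close>; its part with \<open>b = a + c\<close> is the same as that of
    \<open>S\<close>.\<close>
  have T: "t \<in> T \<longleftrightarrow> Inr (?r t) \<in> L.index_set \<or> (t \<in> S \<and> (case t of (a, b, c) \<Rightarrow> b = a + c))" for t
    by (cases t) (auto simp: T_def S_def L.index_set_def)
  have image: "v ` S \<union> w ` T = ?b ` L.index_set"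
  proof (intro equalityI subsetI)
    fix u assume "u \<in> v ` S \<union> w ` T"
    then consider s where "s \<in> S" "u = v s" | t where "t \<in> T" "u = w t" by blast
    then show "u \<in> ?b ` L.index_set"
    proof cases
      case (1 s)
      then show ?thesis by (simp add: S vb)
    next
      case (2 t)
      from 2(1) have "Inr (?r t) \<in> L.index_set \<or> (Inl t \<in> L.index_set \<and> w t = v t)"
        unfolding T S using braid by (cases t) auto
      then show ?thesis
      proof
        assume "Inr (?r t) \<in> L.index_set"
        then show ?thesis unfolding 2(2) wb by (rule imageI)
      next
        assume t: "Inl t \<in> L.index_set \<and> w t = v t"
        then show ?thesis unfolding 2(2) conjunct2[OF t] vb by blast
      qed
    qed
  next
    fix u assume "u \<in> ?b ` L.index_set"
    then obtain i where i: "i \<in> L.index_set" "u = ?b i" by blast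
    show "u \<in> v ` S \<union> w ` T"
    proof (cases i)
      case (Inl s)
      with i show ?thesis by (auto simp: S vb)
    next
      case (Inr t)
      then have "i = Inr (?r (?r t))" by (cases t) simp
      with i have "?r t \<in> T" "u = w (?r t)" by (simp_all only: T wb simp_thms)
      then show ?thesis by blast
    qed
  qed
  note inj = inj_onD[OF L.B_monomial_basis(2)[of \<sigma>\<^sub>1 \<sigma>\<^sub>2]]
  \<comment> \<open>A strict \<open>t\<close> would give an \<open>Inl\<close> equal to an
    \<open>Inr\<close> by injectivity. Otherwise \<open>w t = v t\<close>, and injectivity on the
    left summand applies.\<close>
  have vw: "s = t \<and> (case s of (a, b, c) \<Rightarrow> b = a + c)" if "s \<in> S" "t \<in> T" "v s = w t" for s t
    using that(2) unfolding T
  proof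
    assume "Inr (?r t) \<in> L.index_set"
    with that(1) have "Inl s = Inr (?r t)"
      unfolding S by (intro inj[OF that(3)[unfolded vb wb]])
    then show ?thesis by simp
  next
    assume t: "t \<in> S \<and> (case t of (a, b, c) \<Rightarrow> b = a + c)"
    then have "w t = v t" using braid by (cases t) auto
    with that(3) have "?b (Inl s) = ?b (Inl t)"
      by (simp only: vb)
    from inj[OF this] that(1) t have "Inl s = (Inl t :: _ + nat \<times> nat \<times> nat)"
      unfolding S by blast
    with t show ?thesis by simp
  qed
  have "inj_on v S"
  proof (rule inj_onI)
    fix s t assume "s \<in> S" "t \<in> S" "v s = v t"
    then show "s = t" using inj[of "Inl s" "Inl t"] by (simp add: S vb)
  qed
  moreover have "inj_on w T"
  proof (rule inj_onI)
    fix s t assume st: "s \<in> T" "t \<in> T" "w s = w t"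
    consider "s \<in> S" "w s = v s" | "t \<in> S" "w t = v t" | "Inr (?r s) \<in> L.index_set" "Inr (?r t) \<in> L.index_set"
      using st(1,2) braid unfolding T by (cases s; cases t) auto
    then show "s = t"
    proof cases
      case 1
      then show ?thesis using vw[of s t] st by simp
    next
      case 2
      then show ?thesis using vw[of t s] st by simp
    next
      case 3
      then have "Inr (?r s) = (Inr (?r t) :: nat \<times> nat \<times> nat + _)"
        by (intro inj[OF st(3)[unfolded wb]])
      then show ?thesis by (cases s; cases t) simp
    qed
  qed
  moreover have "is_basis (v ` S \<union> w ` T)"
    unfolding image is_basis_def using L.B_monomial_basis(1) L.span_B_monomial by blast
  moreover have "\<forall>(a, b, c) \<in> S. b = a + c \<longrightarrow> v (a, b, c) = w (a, b, c)"
    using braid by auto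
  moreover have "act (divpow (B1 \<sigma>\<^sub>1) a * divpow (B2 \<sigma>\<^sub>2) b * divpow (B1 \<sigma>\<^sub>1) c) \<eta> = 0 \<longleftrightarrow>
       act (divpow (uF N1) a * divpow (uF N2) b * divpow (uF N1) c) \<eta> = 0" if "a + c \<le> b" for a b c
    using L.dp_iB_eq_0_iff[OF that] by (simp add: act_mult act_divpow B1 B2)
  ultimately show ?thesis using vw by blast
qed

end
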